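(* Assume that $\kappa=\mathfrak{s}=\mathfrak{b}$ and that $P(\kappa)$ holds. Then there is a weakly tight family $\mathscr{A}\subset[\omega]^{\omega}$ of size $\mathfrak{c}$. In particular, weakly tight families of size $\mathfrak{c}$ exist if $\mathfrak{s}\leq\mathfrak{b}<\aleph_\omega$, and in particular, when $\mathfrak{s}=\omega_1$.
   Context: We work in ZFC. $[\omega]^{\omega}$ is the set of infinite subsets of $\omega$, $[\kappa]^{\kappa}$ is the set of subsets of $\kappa$ of size $\kappa$, $\mathfrak{c}=2^{\aleph_0}$, and $\exists^{\infty} n$ means "for infinitely many $n\in\omega$". $\mathfrak{b}$ is the bounding number (least size of an unbounded family in $\omega^{\omega}$ under eventual domination). $\mathfrak{s}$ is the splitting number: the least size of a family $\{e_\alpha:\alpha<\lambda\}\subset[\omega]^{\omega}$ such that for every $b\in[\omega]^{\omega}$ there is $\alpha$ with $|b\cap e_\alpha|=|b\cap(\omega\setminus e_\alpha)|=\omega$. For a cardinal $\kappa>\omega$, $P(\kappa)$ is the following principle: there is a sequence $\langle u_\alpha:\omega\leq\alpha<\kappa\rangle$ such that (1) $u_\alpha\subset\alpha$ and $|u_\alpha|=\omega$ for each $\omega\le\alpha<\kappa$; and (2) for every $\{X_n:n\in\omega\}\subset[\kappa]^{\kappa}$ there is $\alpha$ with $\omega\leq\alpha<\kappa$ such that $\exists^{\infty}n\in\omega\,(u_\alpha\cap X_n\neq\emptyset)$. A family $\mathscr{A}\subset[\omega]^{\omega}$ is almost disjoint (a.d.) if any two distinct members have finite intersection. $\mathcal{I}(\mathscr{A})$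 is the ideal on $\omega$ generated by $\mathscr{A}$ (ideals on $\omega$ contain all finite sets, so $x\in\mathcal{I}(\mathscr{A})$ iff $x\setminus\bigcup\mathcal{F}$ is finite for some finite $\mathcal{F}\subset\mathscr{A}$), and $\mathcal{I}^{+}(\mathscr{A})=\mathcal{P}(\omega)\setminus\mathcal{I}(\mathscr{A})$. An a.d. family $\mathscr{A}\subset[\omega]^{\omega}$ is weakly tight if for every countable collection $\{b_n : n\in\omega\}\subset\mathcal{I}^{+}(\mathscr{A})$ there is $a\in\mathscr{A}$ such that $\exists^{\infty} n\in\omega\,(|b_n\cap a|=\omega)$. *)

theory Defs
  imports "HOL-Library.Infinite_Set"
begin

unbundle cardinal_syntax

section \<open>Cardinals\<close>

text \<open>Cardinals are compared with \<open>=o\<close>, \<open>\<le>o\<close>, \<open><o\<close>, which work across types. The least size of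
  a member of a nonempty collection of sets is determined up to \<open>=o\<close>.\<close>

definition least_size :: "'a set set \<Rightarrow> 'a rel" where
  "least_size \<C> = |SOME A. A \<in> \<C> \<and> (\<forall>B\<in>\<C>. |A| \<le>o |B| )|"

lemma least_size_works:
  assumes "\<C> \<noteq> {}"
  shows "(\<exists>A\<in>\<C>. |A| = least_size \<C>) \<and> (\<forall>B\<in>\<C>. least_size \<C> \<le>o |B| )"
proof -
  have "card_of ` \<C> \<noteq> {}" "\<forall>r\<in>card_of ` \<C>. Card_order r"
    using assms by (auto simp: card_of_Card_order)
  then have "\<exists>A. A \<in> \<C> \<and> (\<forall>B\<in>\<C>. |A| \<le>o |B| )"
    using exists_minim_Card_order[of "card_of ` \<C>"] by blast
  from someI_ex[OF this] show ?thesis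
    unfolding least_size_def by blast
qed

definition continuum :: "(nat \<Rightarrow> bool) rel" where
  "continuum = ctwo ^c natLeq"

definition omega_1 :: "nat set rel" where
  "omega_1 = cardSuc natLeq"

primrec is_aleph :: "nat \<Rightarrow> 'a rel \<Rightarrow> bool" where
  "is_aleph 0 r \<longleftrightarrow> Card_order r \<and> r =o natLeq"
| "is_aleph (Suc n) r \<longleftrightarrow> Card_order r \<and> (\<exists>q :: 'a rel. is_aleph n q \<and> r =o cardSuc q)"

text \<open>The existence of a cardinal \<open>\<aleph>\<^sub>\<omega>\<close> on some type is not provable in HOL. Being smaller than
  \<open>\<aleph>\<^sub>\<omega>\<close> is therefore expressed through \<open>\<aleph>\<^sub>\<omega> = sup\<^sub>n \<aleph>\<^sub>n\<close>, without asking for \<open>\<aleph>\<^sub>\<omega>\<close> to exist;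
  lemma \<open>below_aleph_omega_iff\<close> shows that this is \<open>r <o \<aleph>\<^sub>\<omega>\<close> whenever it does.\<close>

definition below_aleph_omega :: "'a rel \<Rightarrow> bool" where
  "below_aleph_omega r \<longleftrightarrow> r <o natLeq \<or> (\<exists>n. is_aleph n r)"

definition is_aleph_omega :: "'a rel \<Rightarrow> bool" where
  "is_aleph_omega l \<longleftrightarrow> Card_order l \<and> (\<forall>n. \<exists>q :: 'a rel. is_aleph n q \<and> q <o l) \<and>
     (\<forall>m :: 'a rel. Card_order m \<and> (\<forall>n. \<exists>q :: 'a rel. is_aleph n q \<and> q <o m) \<longrightarrow> l \<le>o m)"

lemma is_aleph_Card_order: "is_aleph n r \<Longrightarrow> Card_order r"
  by (cases n) auto

lemma is_aleph_unique:
  fixes r :: "'a rel" and q :: "'b rel"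
  shows "is_aleph n r \<Longrightarrow> is_aleph n q \<Longrightarrow> r =o q"
proof (induction n arbitrary: r q)
  case 0
  then show ?case by (auto intro: ordIso_transitive ordIso_symmetric)
next
  case (Suc n)
  obtain r' :: "'a rel" where r': "is_aleph n r'" "r =o cardSuc r'" using Suc.prems by auto
  obtain q' :: "'b rel" where q': "is_aleph n q'" "q =o cardSuc q'" using Suc.prems by auto
  have "cardSuc r' =o cardSuc q'"
    using cardSuc_invar_ordIso[OF is_aleph_Card_order[OF r'(1)] is_aleph_Card_order[OF q'(1)]]
      Suc.IH[OF r'(1) q'(1)] by blast
  then show ?case
    using ordIso_transitive[OF r'(2) ordIso_transitive[OF _ ordIso_symmetric[OF q'(2)]]] by blast
qed

lemma is_aleph_ordIso:
  fixes r r' :: "'a rel"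
  assumes "is_aleph n r" "Card_order r'" "r' =o r"
  shows "is_aleph n r'"
proof (cases n)
  case 0
  then have "r =o natLeq" using assms(1) by simp
  then have "r' =o natLeq" by (rule ordIso_transitive[OF assms(3)])
  then show ?thesis using 0 assms(2) by simp
next
  case (Suc k)
  then obtain q :: "'a rel" where q: "is_aleph k q" "r =o cardSuc q" using assms(1) by auto
  have "r' =o cardSuc q" by (rule ordIso_transitive[OF assms(3) q(2)])
  then show ?thesis using Suc assms(2) q(1) by auto
qed

lemma Card_order_copy:
  fixes r :: "'a rel" and l :: "'b rel"
  assumes "Card_order r" "Card_order l" "r \<le>o l"
  obtains q :: "'b rel" where "Card_order q" "q =o r"
proof -
  have "|Field r| \<le>o l"
    by (rule ordIso_ordLeq_trans[OF card_of_Field_ordIso[OF assms(1)] assms(3)])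
  from iffD1[OF internalize_card_of_ordLeq this]
  obtain B where B: "B \<subseteq> Field l" "|Field r| =o |B|"
    by (elim exE conjE) (rule that)
  have "|B| =o r"
    by (rule ordIso_transitive[OF ordIso_symmetric[OF B(2)] card_of_Field_ordIso[OF assms(1)]])
  with card_of_Card_order show thesis by (rule that)
qed

lemma is_aleph_transfer:
  fixes r :: "'a rel" and l :: "'b rel"
  assumes "is_aleph n r" "Card_order l" "r \<le>o l"
  obtains q :: "'b rel" where "is_aleph n q" "q =o r"
proof -
  have "\<exists>q :: 'b rel. is_aleph n q \<and> q =o r"
    using assms(1,3)
  proof (induction n arbitrary: r)
    case 0
    obtain q :: "'b rel" where "Card_order q" "q =o r"
      using Card_order_copy[of r l] 0 assms(2) is_aleph_Card_order by blast
    then show ?case using 0 ordIso_transitive by auto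
  next
    case (Suc n)
    obtain r' :: "'a rel" where r': "is_aleph n r'" "r =o cardSuc r'" using Suc.prems by auto
    have "r' \<le>o r"
      using cardSuc_ordLeq[OF is_aleph_Card_order[OF r'(1)]] r'(2)
        ordIso_symmetric ordLeq_ordIso_trans by blast
    then have "r' \<le>o l" using Suc.prems(2) ordLeq_transitive by blast
    then obtain q' :: "'b rel" where q': "is_aleph n q'" "q' =o r'"
      using Suc.IH r'(1) by blast
    obtain q :: "'b rel" where q: "Card_order q" "q =o r"
      using Card_order_copy[of r l] Suc.prems assms(2) is_aleph_Card_order by blast
    have "cardSuc r' =o cardSuc q'"
        using cardSuc_invar_ordIso[OF is_aleph_Card_order[OF r'(1)] is_aleph_Card_order[OF q'(1)]]
        ordIso_symmetric[OF q'(2)] by blast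
    then have "q =o cardSuc q'"
      using ordIso_transitive[OF q(2) ordIso_transitive[OF r'(2)]] by blast
    then show ?case using q q'(1) by auto
  qed
  then show thesis using that by blast
qed

lemma below_aleph_omega_iff:
  fixes r :: "'a rel" and l :: "'b rel"
  assumes l: "is_aleph_omega l" and r: "Card_order r"
  shows "below_aleph_omega r \<longleftrightarrow> r <o l"
proof
  assume "below_aleph_omega r"
  then consider "r <o natLeq" | n where "is_aleph n r"
    unfolding below_aleph_omega_def by blast
  then show "r <o l"
  proof cases
    case 1
    obtain q :: "'b rel" where "is_aleph 0 q" "q <o l"
      using l unfolding is_aleph_omega_def by blast
    then have "natLeq =o q" "q <o l" by (simp_all add: ordIso_symmetric)
    then have "natLeq <o l" by (rule ordIso_ordLess_trans)
    then show ?thesis using 1 ordLess_transitive by blast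
  next
    case 2
    obtain q :: "'b rel" where "is_aleph n q" "q <o l"
      using l unfolding is_aleph_omega_def by blast
    then show ?thesis
      using is_aleph_unique[OF 2] ordIso_ordLess_trans by blast
  qed
next
  have lc: "Card_order l" using l unfolding is_aleph_omega_def by blast
  assume rl: "r <o l"
  show "below_aleph_omega r"
  proof (rule ccontr)
    assume nb: "\<not> below_aleph_omega r"
    obtain m :: "'b rel" where m: "Card_order m" "m =o r"
      using Card_order_copy[OF r lc] rl ordLess_imp_ordLeq by blast
    have "\<exists>q :: 'b rel. is_aleph n q \<and> q <o m" for n
    proof (induction n)
      case 0
      obtain q :: "'b rel" where q: "is_aleph 0 q" "q <o l"
        using l unfolding is_aleph_omega_def by blast
      have "q \<le>o r"
      proof -
        have "natLeq \<le>o r"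
          using nb r natLeq_Card_order unfolding below_aleph_omega_def
          by (meson card_order_on_well_order_on not_ordLess_iff_ordLeq)
        then show ?thesis using q(1) ordIso_ordLeq_trans by auto
      qed
      moreover have "\<not> r =o q"
      proof
        assume "r =o q"
        moreover have "q =o natLeq" using q(1) by simp
        ultimately have "r =o natLeq" by (rule ordIso_transitive)
        then have "is_aleph 0 r" using r by simp
        then show False using nb unfolding below_aleph_omega_def by blast
      qed
      ultimately have "q <o r"
        using ordLeq_iff_ordLess_or_ordIso ordIso_symmetric by blast
      then show ?case using q m ordLess_ordIso_trans ordIso_symmetric by blast
    next
      case (Suc n)
      then obtain p :: "'b rel" where p: "is_aleph n p" "p <o m" by blast
      obtain q :: "'b rel" where q: "is_aleph (Suc n) q"
        using l unfolding is_aleph_omega_def by blast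
      obtain p' :: "'b rel" where p': "is_aleph n p'" "q =o cardSuc p'" using q by auto
      have pp: "p' =o p" using is_aleph_unique p' p by blast
      then have "p' <o m" using p(2) ordIso_ordLess_trans by blast
      then have "cardSuc p' \<le>o m"
        using cardSuc_least m(1) is_aleph_Card_order p'(1) by blast
      then have "q \<le>o m" using p'(2) ordIso_ordLeq_trans by blast
      moreover have "\<not> m =o q"
      proof
        assume "m =o q"
        then have "r =o q" using m(2) ordIso_symmetric ordIso_transitive by blast
        obtain r' :: "'a rel" where "is_aleph (Suc n) r'" "r' =o q"
          using is_aleph_transfer[OF q r] \<open>r =o q\<close> ordIso_symmetric ordIso_imp_ordLeq by blast
        then have "is_aleph (Suc n) r"
          using is_aleph_ordIso[OF _ r] ordIso_transitive[OF \<open>r =o q\<close>] ordIso_symmetric by blast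
        then show False using nb unfolding below_aleph_omega_def by blast
      qed
      ultimately have "q <o m"
        using ordLeq_iff_ordLess_or_ordIso ordIso_symmetric by blast
      then show ?case using q by blast
    qed
    then have "l \<le>o m" using l m(1) unfolding is_aleph_omega_def by blast
    then have "l \<le>o r" using m(2) ordLeq_ordIso_trans by blast
    then show False using rl not_ordLess_ordLeq by blast
  qed
qed

section \<open>Cardinal invariants\<close>

definition eventually_dominated :: "(nat \<Rightarrow> nat) \<Rightarrow> (nat \<Rightarrow> nat) \<Rightarrow> bool"  (infix "\<le>\<^sup>*" 50) where
  "f \<le>\<^sup>* g \<longleftrightarrow> (\<forall>\<^sub>\<infinity>n. f n \<le> g n)"

definition unbounded_family :: "(nat \<Rightarrow> nat) set \<Rightarrow> bool" where
  "unbounded_family F \<longleftrightarrow> \<not> (\<exists>g. \<forall>f\<in>F. f \<le>\<^sup>* g)"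

definition bounding_number :: "(nat \<Rightarrow> nat) rel"  ("\<bb>") where
  "\<bb> = least_size {F. unbounded_family F}"

definition splitting_family :: "nat set set \<Rightarrow> bool" where
  "splitting_family E \<longleftrightarrow> (\<forall>e\<in>E. infinite e) \<and>
     (\<forall>b. infinite b \<longrightarrow> (\<exists>e\<in>E. infinite (b \<inter> e) \<and> infinite (b \<inter> (UNIV - e))))"

definition splitting_number :: "nat set rel"  ("\<ss>") where
  "\<ss> = least_size {E. splitting_family E}"

lemma unbounded_family_UNIV: "unbounded_family UNIV"
proof -
  have "\<not> (\<lambda>n. Suc (g n)) \<le>\<^sup>* g" for g
    unfolding eventually_dominated_def by simp
  then show ?thesis unfolding unbounded_family_def by blast
qed

lemma splitting_family_infinite_sets: "splitting_family {e. infinite e}"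
  unfolding splitting_family_def
proof (intro conjI allI impI)
  fix b :: "nat set" assume b: "infinite b"
  define e where "e = (\<lambda>n. enumerate b (2 * n)) ` UNIV"
  define d where "d = (\<lambda>n. enumerate b (2 * n + 1)) ` UNIV"
  have inj: "enumerate b m = enumerate b n \<longleftrightarrow> m = n" for m n
    using strict_mono_enumerate[OF b] strict_mono_eq by blast
  have "infinite e" "infinite d"
    unfolding e_def d_def by (auto intro!: range_inj_infinite injI simp: inj)
  have "e \<subseteq> b" "d \<subseteq> b" "d \<inter> e = {}"
    unfolding e_def d_def using enumerate_in_set[OF b] by (auto simp: inj) presburger
  then have "b \<inter> e = e" "d \<subseteq> b \<inter> (UNIV - e)" by blast+
  with \<open>infinite e\<close> \<open>infinite d\<close> have "infinite (b \<inter> e)" "infinite (b \<inter> (UNIV - e))"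
    by (simp, metis infinite_super)
  with \<open>infinite e\<close> show "\<exists>e\<in>{e. infinite e}. infinite (b \<inter> e) \<and> infinite (b \<inter> (UNIV - e))"
    by blast
qed auto

text \<open>A cardinal is a \<open>Card_order\<close> \<open>\<kappa>\<close>; its field plays the role of the set of ordinals below \<open>\<kappa>\<close>,
  and \<open>underS \<kappa> \<alpha>\<close>, the set of strict predecessors, that of the ordinal \<open>\<alpha>\<close>. Thus \<open>\<omega> \<le> \<alpha>\<close> means
  that \<open>underS \<kappa> \<alpha>\<close> is infinite. The principle is meant for uncountable \<open>\<kappa>\<close>; for \<open>\<kappa> \<le>o natLeq\<close>
  there is no such \<open>\<alpha>\<close>.\<close>

definition P_principle :: "'k rel \<Rightarrow> bool" where
  "P_principle \<kappa> \<longleftrightarrow> (\<exists>u :: 'k \<Rightarrow> 'k set.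
     (\<forall>\<alpha>\<in>Field \<kappa>. infinite (underS \<kappa> \<alpha>) \<longrightarrow> u \<alpha> \<subseteq> underS \<kappa> \<alpha> \<and> |u \<alpha>| =o natLeq) \<and>
     (\<forall>X :: nat \<Rightarrow> 'k set. (\<forall>n. X n \<subseteq> Field \<kappa> \<and> |X n| =o \<kappa>) \<longrightarrow>
        (\<exists>\<alpha>\<in>Field \<kappa>. infinite (underS \<kappa> \<alpha>) \<and> (\<exists>\<^sub>\<infinity>n. u \<alpha> \<inter> X n \<noteq> {}))))"

section \<open>Weakly tight families\<close>

definition almost_disjoint :: "nat set set \<Rightarrow> bool" where
  "almost_disjoint \<A> \<longleftrightarrow> (\<forall>a\<in>\<A>. infinite a) \<and> (\<forall>a\<in>\<A>. \<forall>b\<in>\<A>. a \<noteq> b \<longrightarrow> finite (a \<inter> b))"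

text \<open>Ideals contain all finite sets and need not be proper.\<close>

definition ideal_on_omega :: "nat set set \<Rightarrow> bool" where
  "ideal_on_omega I \<longleftrightarrow> (\<forall>x. finite x \<longrightarrow> x \<in> I) \<and> (\<forall>x\<in>I. \<forall>y. y \<subseteq> x \<longrightarrow> y \<in> I) \<and>
     (\<forall>x\<in>I. \<forall>y\<in>I. x \<union> y \<in> I)"

definition generated_ideal :: "nat set set \<Rightarrow> nat set set"  ("\<I>") where
  "\<I> \<A> = \<Inter> {I. ideal_on_omega I \<and> \<A> \<subseteq> I}"

definition positive_sets :: "nat set set \<Rightarrow> nat set set"  ("\<I>\<^sup>+") where
  "\<I>\<^sup>+ \<A> = UNIV - \<I> \<A>"

lemma mem_generated_ideal_iff:
  "x \<in> \<I> \<A> \<longleftrightarrow> (\<exists>\<F>. finite \<F> \<and> \<F> \<subseteq> \<A> \<and> finite (x - \<Union>\<F>))"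
proof
  let ?J = "{x. \<exists>\<F>. finite \<F> \<and> \<F> \<subseteq> \<A> \<and> finite (x - \<Union>\<F>)}"
  have "ideal_on_omega ?J"
    unfolding ideal_on_omega_def
  proof (intro conjI allI ballI impI)
    fix x :: "nat set" assume "finite x"
    then show "x \<in> ?J" by (auto intro!: exI[of _ "{}"])
  next
    fix x y :: "nat set" assume "x \<in> ?J" "y \<subseteq> x"
    then obtain \<F> where "finite \<F>" "\<F> \<subseteq> \<A>" "finite (x - \<Union>\<F>)" by blast
    moreover have "y - \<Union>\<F> \<subseteq> x - \<Union>\<F>" using \<open>y \<subseteq> x\<close> by blast
    moreover have "finite (y - \<Union>\<F>)" using calculation(4,3) by (rule finite_subset)
    ultimately show "y \<in> ?J" by blast
  next
    fix x y assume "x \<in> ?J" "y \<in> ?J"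
    then obtain \<F> \<G> where *: "finite \<F>" "\<F> \<subseteq> \<A>" "finite (x - \<Union>\<F>)"
      "finite \<G>" "\<G> \<subseteq> \<A>" "finite (y - \<Union>\<G>)" by blast
    have "x \<union> y - \<Union>(\<F> \<union> \<G>) \<subseteq> (x - \<Union>\<F>) \<union> (y - \<Union>\<G>)" by blast
    then have "finite (x \<union> y - \<Union>(\<F> \<union> \<G>))" by (rule finite_subset) (simp add: *)
    moreover have "finite (\<F> \<union> \<G>)" "\<F> \<union> \<G> \<subseteq> \<A>" using * by auto
    ultimately show "x \<union> y \<in> ?J" by blast
  qed
  moreover have "\<A> \<subseteq> ?J"
  proof
    fix a assume "a \<in> \<A>"
    then show "a \<in> ?J" by (auto intro!: exI[of _ "{a}"])
  qed
  moreover assume "x \<in> \<I> \<A>"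
  ultimately show "\<exists>\<F>. finite \<F> \<and> \<F> \<subseteq> \<A> \<and> finite (x - \<Union>\<F>)"
    unfolding generated_ideal_def by blast
next
  assume "\<exists>\<F>. finite \<F> \<and> \<F> \<subseteq> \<A> \<and> finite (x - \<Union>\<F>)"
  then obtain \<F> where F: "finite \<F>" "\<F> \<subseteq> \<A>" "finite (x - \<Union>\<F>)" by blast
  have "x \<in> I" if I: "ideal_on_omega I" "\<A> \<subseteq> I" for I
  proof -
    have sub: "\<And>x y. x \<in> I \<Longrightarrow> y \<subseteq> x \<Longrightarrow> y \<in> I"
      and un: "\<And>x y. x \<in> I \<Longrightarrow> y \<in> I \<Longrightarrow> x \<union> y \<in> I"
      and fin: "\<And>x. finite x \<Longrightarrow> x \<in> I"
      using I(1) by (simp_all add: ideal_on_omega_def)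
    have "\<Union>\<F> \<in> I" using F(1,2)
    proof (induction rule: finite_induct)
      case empty
      then show ?case using fin by simp
    next
      case (insert a \<F>)
      then show ?case using un[of a "\<Union>\<F>"] I(2) by auto
    qed
    then have "(x - \<Union>\<F>) \<union> \<Union>\<F> \<in> I" by (rule un[OF fin[OF F(3)]])
    then show "x \<in> I" by (rule sub) blast
  qed
  then show "x \<in> \<I> \<A>" unfolding generated_ideal_def by blast
qed

definition weakly_tight :: "nat set set \<Rightarrow> bool" where
  "weakly_tight \<A> \<longleftrightarrow> almost_disjoint \<A> \<and>
     (\<forall>b :: nat \<Rightarrow> nat set. (\<forall>n. b n \<in> \<I>\<^sup>+ \<A>) \<longrightarrow>
        (\<exists>a\<in>\<A>. \<exists>\<^sub>\<infinity>n. infinite (b n \<inter> a)))"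

end

(* From s <= b one gets a family E of at most b sets such that every
   sequence of infinite sets is split by some e in E, in the sense that infinitely many terms meet e
   in an infinite set and infinitely many meet the complement of e in an infinite set. Well-order E
   in its least order type. The type of a sequence Q is the sequence of sides of the members of E
   before the first e that splits Q: almost every term of Q is almost contained in each of these
   sides. Cutting Q by e and by its complement prolongs the type in two incompatible ways, so
   iterating this omega times and diagonalising gives continuum many subsequences of subsets of Q
   with pairwise incompatible types.

   The family is built by recursion of length c, where every member carries countably many types,
   and no new type is an initial segment of an old one; this can be arranged because there are
   fewer than c old types. Then an old type is either incompatible with a new type, which makes the
   corresponding sets almost disjoint, or a proper initial segment of it. There are fewer than b such
   segments, and a single function dominates all the requirements that come from them. *)
theory Submission
  imports Defs "HOL-Library.Countable_Set_Type"
begin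

section \<open>Domination below the bounding number\<close>

lemma dominated_if_less_bounding_number:
  assumes "|F| <o \<bb>"
  obtains g where "\<And>f. f \<in> F \<Longrightarrow> f \<le>\<^sup>* g"
proof -
  have "\<bb> \<le>o |F|" if "unbounded_family F"
    using least_size_works[of "{F. unbounded_family F}"] unbounded_family_UNIV that
    unfolding bounding_number_def by blast
  then have "\<not> unbounded_family F"
    using assms not_ordLess_ordLeq by blast
  then show thesis using that unfolding unbounded_family_def by blast
qed

text \<open>Diagonalisation: \<open>g n\<close> is the maximum at \<open>n\<close> of the first
  \<open>n + 1\<close> functions of an enumeration, so \<open>g\<close> bounds the
  \<open>i\<close>-th one from \<open>i\<close> on.\<close>

lemma dominated_if_countable:
  assumes "countable F"
  obtains g where "\<And>f. f \<in> F \<Longrightarrow> f \<le>\<^sup>* g"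
proof (cases "F = {}")
  case True
  then show thesis using that by blast
next
  case False
  define g where "g n = Max ((\<lambda>i. from_nat_into F i n) ` {..n})" for n
  have "f \<le>\<^sup>* g" if f: "f \<in> F" for f
  proof -
    obtain i where i: "from_nat_into F i = f"
      using from_nat_into_surj[OF assms f] by (elim exE)
    have "f n \<le> g n" if "n \<ge> i" for n
    proof -
      have "f n \<in> (\<lambda>i. from_nat_into F i n) ` {..n}"
        by (rule image_eqI[of _ _ i]) (use i that in simp_all)
      then show ?thesis unfolding g_def by (rule Max_ge[OF finite_imageI[OF finite_atMost]])
    qed
    then show ?thesis
      unfolding eventually_dominated_def MOST_nat_le by (intro exI[of _ i]) simp
  qed
  then show thesis by (rule that)
qed

lemma bounding_number_witness:
  obtains B where "unbounded_family B" "|B| = \<bb>"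
  using least_size_works[of "{F. unbounded_family F}"] unbounded_family_UNIV
  unfolding bounding_number_def by blast

lemma natLeq_less_bounding_number: "natLeq <o \<bb>"
proof -
  obtain B where B: "unbounded_family B" "|B| = \<bb>" by (rule bounding_number_witness)
  have "\<not> countable B"
    using B(1) dominated_if_countable unfolding unbounded_family_def by metis
  then have "\<not> |B| \<le>o natLeq" by (simp add: countable_card_le_natLeq)
  then have "natLeq <o |B|"
    using natLeq_Well_order card_of_Well_order not_ordLeq_iff_ordLess by blast
  then show ?thesis using B(2) by simp
qed

text \<open>Domination in two stages: each countable \<open>F i\<close> first gets a bound of its
  own, then these fewer than \<bb> bounds get a common one. The \<open>X j\<close> are finite sets
  of exceptions that the tail from \<open>g j\<close> on has to miss.\<close>

lemma eventually_avoid: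
  fixes F :: "'i \<Rightarrow> (nat \<Rightarrow> nat set) set"
  assumes "|I| <o \<bb>" and "\<And>i. i \<in> I \<Longrightarrow> countable (F i)"
    and fin: "\<And>i X. i \<in> I \<Longrightarrow> X \<in> F i \<Longrightarrow> \<forall>\<^sub>\<infinity>j. finite (X j)"
  shows "\<exists>g. \<forall>i\<in>I. \<forall>X\<in>F i. \<forall>\<^sub>\<infinity>j. X j \<inter> {g j..} = {}"
proof -
  \<comment> \<open>For finite \<open>X j\<close> this exceeds every member of \<open>X j\<close>;
    the inserted 0 keeps \<open>Max\<close> meaningful when \<open>X j\<close> is empty.\<close>
  define bnd where "bnd X j = Suc (Max (insert 0 (X j)))" for X :: "nat \<Rightarrow> nat set" and j
  have bnd: "X j \<inter> {m..} = {}" if "finite (X j)" "bnd X j \<le> m" for X j m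
    using that Max_ge[of "insert 0 (X j)"] unfolding bnd_def by fastforce
  have "\<exists>h. \<forall>f \<in> bnd ` F i. f \<le>\<^sup>* h" if i: "i \<in> I" for i
  proof -
    have "countable (bnd ` F i)" using assms(2)[OF i] by (rule countable_image)
    then obtain h where "\<And>f. f \<in> bnd ` F i \<Longrightarrow> f \<le>\<^sup>* h"
      using dominated_if_countable by metis
    then show ?thesis by (intro exI ballI)
  qed
  then have "\<forall>i\<in>I. \<exists>h. \<forall>f \<in> bnd ` F i. f \<le>\<^sup>* h" by (rule ballI)
  from bchoice[OF this] obtain h where "\<forall>i\<in>I. \<forall>f \<in> bnd ` F i. f \<le>\<^sup>* h i" by (elim exE)
  then have h: "bnd X \<le>\<^sup>* h i" if "i \<in> I" "X \<in> F i" for i X using that by blast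
  have "|h ` I| <o \<bb>" by (rule ordLeq_ordLess_trans[OF card_of_image assms(1)])
  then obtain g where "\<And>f. f \<in> h ` I \<Longrightarrow> f \<le>\<^sup>* g"
    using dominated_if_less_bounding_number by metis
  then have g: "h i \<le>\<^sup>* g" if "i \<in> I" for i using that by simp
  have "\<forall>\<^sub>\<infinity>j. X j \<inter> {g j..} = {}" if "i \<in> I" "X \<in> F i" for i X
    using h[OF that] g[OF that(1)] fin[OF that] unfolding eventually_dominated_def
    by eventually_elim (rule bnd, auto)
  then show ?thesis by blast
qed

section \<open>Sequences of sets\<close>

text \<open>Sequences take the place of single sets because weak tightness asks for only infinitely
  many terms to be met; this is the matching notion of largeness.\<close>

definition big :: "(nat \<Rightarrow> nat set) \<Rightarrow> bool" where
  "big Q \<longleftrightarrow> (\<exists>\<^sub>\<infinity>n. infinite (Q n))"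

lemma big_mono:
  assumes "big Q" "\<forall>\<^sub>\<infinity>n. Q n \<subseteq> R n"
  shows "big R"
proof -
  have "\<exists>\<^sub>\<infinity>n. infinite (Q n) \<and> Q n \<subseteq> R n"
    using assms unfolding big_def by (metis INFM_conjI)
  then show ?thesis unfolding big_def
    by (rule INFM_mono) (meson finite_subset)
qed

lemma not_big_iff: "\<not> big Q \<longleftrightarrow> (\<forall>\<^sub>\<infinity>n. finite (Q n))"
  unfolding big_def not_INFM by simp

section \<open>Block partitions obtained from unbounded families\<close>

definition block :: "(nat \<Rightarrow> nat) \<Rightarrow> nat \<Rightarrow> nat set" where
  "block p k = {p k..<p (Suc k)}"

lemma disjoint_blocks:
  assumes "strict_mono p" "x \<in> block p k" "x \<in> block p l"
  shows "k = l"
proof -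
  have "False" if "i < j" "x \<in> block p i" "x \<in> block p j" for i j
    using that strict_mono_less_eq[OF assms(1), of "Suc i" j] unfolding block_def by auto
  then show ?thesis using assms(2,3) by (meson linorder_neqE)
qed

lemma block_cover:
  assumes "strict_mono p" "p 0 = (0::nat)"
  obtains k where "x \<in> block p k"
proof -
  define k where "k = (LEAST k. x < p (Suc k))"
  have "x < p (Suc x)"
    using strict_mono_imp_increasing[OF assms(1), of "Suc x"] by simp
  then have k: "x < p (Suc k)" unfolding k_def by (rule LeastI)
  have "p k \<le> x"
  proof (cases k)
    case (Suc l)
    then have "\<not> x < p (Suc l)" unfolding k_def using not_less_Least[of l] by (metis lessI)
    then show ?thesis using Suc by simp
  qed (simp add: assms(2))
  then show thesis using that[of k] k unfolding block_def by simp
qed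

lemma infinite_Int_union_of_blocks:
  assumes p: "strict_mono p" and "infinite X"
    and hit: "\<And>k. k \<in> X \<Longrightarrow> k \<ge> i \<Longrightarrow> Q \<inter> block p k \<noteq> {}"
  shows "infinite (Q \<inter> (\<Union>k\<in>X. block p k))"
  unfolding infinite_nat_iff_unbounded_le
proof
  fix m
  obtain k where k: "k \<in> X" "k \<ge> max i m"
    using assms(2) unfolding infinite_nat_iff_unbounded_le by blast
  then obtain x where x: "x \<in> Q" "x \<in> block p k" using hit by fastforce
  have "m \<le> p k" using strict_mono_imp_increasing[OF p, of k] k(2) by simp
  then have "m \<le> x" using x(2) unfolding block_def by simp
  with x k show "\<exists>n\<ge>m. n \<in> Q \<inter> (\<Union>k\<in>X. block p k)" by blast
qed

text \<open>The block partition attached to \<open>f\<close> has the endpoints \<open>0, f 0, f (f 0), \<dots>\<close>. If \<open>f\<close> is not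
  dominated by \<open>g \<circ> g\<close>, then infinitely often \<open>[n, g n)\<close> fits into a block, because of any
  two adjacent blocks that cover \<open>[n, f n)\<close> one contains such an interval.\<close>

definition iterates :: "(nat \<Rightarrow> nat) \<Rightarrow> nat \<Rightarrow> nat" where
  "iterates f k = (f ^^ k) 0"

lemma strict_mono_iterates: "(\<And>n. n < f n) \<Longrightarrow> strict_mono (iterates f)"
  unfolding iterates_def by (intro strict_mono_Suc_iff[THEN iffD2]) simp

lemma infinite_blocks_containing:
  assumes f: "mono f" "\<And>n. n < f n" and g: "mono g" "\<And>n. n \<le> g n"
    and undom: "\<not> f \<le>\<^sup>* (\<lambda>n. g (g n))"
  shows "infinite {k. \<exists>n\<ge>k. {n..<g n} \<subseteq> block (iterates f) k}"
  unfolding infinite_nat_iff_unbounded_le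
proof
  fix m
  let ?p = "iterates f"
  have p: "strict_mono ?p" using f(2) by (rule strict_mono_iterates)
  have pS: "?p (Suc k) = f (?p k)" for k unfolding iterates_def by simp
  have inc: "k \<le> ?p k" for k using strict_mono_imp_increasing[OF p] .
  obtain n where n: "n \<ge> ?p m" "g (g n) < f n"
    using undom unfolding eventually_dominated_def MOST_nat_le by (metis not_le)
  obtain k where k: "n \<in> block ?p k"
    using block_cover[OF p] by (metis iterates_def funpow_0)
  then have nk: "?p k \<le> n" "n < ?p (Suc k)" unfolding block_def by auto
  have "?p m < ?p (Suc k)" using n(1) nk(2) by simp
  then have mk: "m \<le> k" using p by (simp add: strict_mono_less)
  show "\<exists>k\<ge>m. k \<in> {k. \<exists>n\<ge>k. {n..<g n} \<subseteq> block ?p k}"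
  proof (cases "g n \<le> ?p (Suc k)")
    case True
    then have "{n..<g n} \<subseteq> block ?p k" using nk unfolding block_def by auto
    moreover have "n \<ge> k" using inc[of k] nk by simp
    ultimately show ?thesis using mk by blast
  next
    \<comment> \<open>Here \<open>[n, g n)\<close> runs past the right end of its block. As
      \<open>g (g n) < f n\<close>, the interval that starts at this end fits into the next
      block.\<close>
    case False
    then have "g (?p (Suc k)) \<le> g (g n)" using g(1) by (simp add: monoD)
    also have "\<dots> < f n" by (rule n)
    also have "\<dots> \<le> ?p (Suc (Suc k))"
      unfolding pS[of "Suc k"] using f(1) nk by (simp add: monoD)
    finally have "{?p (Suc k)..<g (?p (Suc k))} \<subseteq> block ?p (Suc k)"
      unfolding block_def by auto
    moreover have "?p (Suc k) \<ge> Suc k" by (rule inc)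
    ultimately show ?thesis using mk le_SucI by blast
  qed
qed

text \<open>Block partitions need a monotone function strictly above the identity. Lying above
  \<open>f\<close>, the majorant is undominated wherever \<open>f\<close> is.\<close>

definition monotone_majorant :: "(nat \<Rightarrow> nat) \<Rightarrow> nat \<Rightarrow> nat" where
  "monotone_majorant f n = n + Suc (Max (f ` {..n}))"

lemma monotone_majorant:
  "mono (monotone_majorant f)" "n < monotone_majorant f n" "f n \<le> monotone_majorant f n"
proof -
  show "mono (monotone_majorant f)"
    unfolding monotone_majorant_def
    by (intro monoI add_mono) (auto intro!: Max_mono simp: image_mono)
  have "f n \<le> Max (f ` {..n})" by (rule Max_ge) auto
  then show "f n \<le> monotone_majorant f n" unfolding monotone_majorant_def by linarith
qed (simp add: monotone_majorant_def)

text \<open>Let \<open>[n, g n)\<close> meet every infinite \<open>Q i\<close> with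
  \<open>i \<le> n\<close>. A member \<open>f\<close> of \<open>B\<close> that
  \<open>g \<circ> g\<close> does not dominate has infinitely many blocks \<open>k\<close>
  containing such an interval with \<open>k \<le> n\<close>, and these blocks meet every infinite
  \<open>Q i\<close> with \<open>i \<le> k\<close>.\<close>

lemma infinite_blocks_meeting:
  assumes unb: "unbounded_family B"
  obtains f where "f \<in> B"
    "infinite {k. \<forall>i\<le>k. infinite (Q i) \<longrightarrow> Q i \<inter> block (iterates (monotone_majorant f)) k \<noteq> {}}"
proof -
  have "\<exists>m\<ge>n. \<forall>i\<le>n. infinite (Q i) \<longrightarrow> Q i \<inter> {n..<m} \<noteq> {}" for n
  proof -
    have "\<exists>x\<ge>n. x \<in> Q i" if "infinite (Q i)" for i
      using that unfolding infinite_nat_iff_unbounded_le by blast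
    then obtain x where x: "\<And>i. infinite (Q i) \<Longrightarrow> x i \<ge> n \<and> x i \<in> Q i" by metis
    have "x i < n + Suc (Max (x ` {..n}))" if "i \<le> n" for i
      
    proof -
      have "x i \<le> Max (x ` {..n})" using that by (intro Max_ge) auto
      then show ?thesis by linarith
    qed
    then have "Q i \<inter> {n..<n + Suc (Max (x ` {..n}))} \<noteq> {}" if "i \<le> n" "infinite (Q i)" for i
      using x[of i] that by (auto simp: disjoint_iff intro!: exI[of _ "x i"])
    then show ?thesis by (intro exI[of _ "n + Suc (Max (x ` {..n}))"]) auto
  qed
  then obtain g0 where g0: "\<And>n. g0 n \<ge> n"
    "\<And>n i. i \<le> n \<Longrightarrow> infinite (Q i) \<Longrightarrow> Q i \<inter> {n..<g0 n} \<noteq> {}" by metis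
  define g where "g = monotone_majorant g0"
  have g: "mono g" "\<And>n. n \<le> g n" "\<And>n. g0 n \<le> g n"
    unfolding g_def using monotone_majorant by (auto simp: less_imp_le)
  obtain f where f: "f \<in> B" "\<not> f \<le>\<^sup>* (\<lambda>n. g (g n))"
    using unb unfolding unbounded_family_def by blast
  let ?f = "monotone_majorant f"
  have "\<not> ?f \<le>\<^sup>* (\<lambda>n. g (g n))"
  proof
    assume "?f \<le>\<^sup>* (\<lambda>n. g (g n))"
    then have "f \<le>\<^sup>* (\<lambda>n. g (g n))"
      unfolding eventually_dominated_def
      by eventually_elim (use monotone_majorant(3) le_trans in blast)
    with f(2) show False ..
  qed
  then have "infinite {k. \<exists>n\<ge>k. {n..<g n} \<subseteq> block (iterates ?f) k}"
    using g(1,2) by (intro infinite_blocks_containing monotone_majorant)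
  moreover have "{k. \<exists>n\<ge>k. {n..<g n} \<subseteq> block (iterates ?f) k} \<subseteq>
      {k. \<forall>i\<le>k. infinite (Q i) \<longrightarrow> Q i \<inter> block (iterates ?f) k \<noteq> {}}"
  proof clarify
    fix k n i
    assume *: "k \<le> n" "{n..<g n} \<subseteq> block (iterates ?f) k" "i \<le> k" "infinite (Q i)"
      "Q i \<inter> block (iterates ?f) k = {}"
    have "Q i \<inter> {n..<g0 n} \<noteq> {}" using * by (intro g0) auto
    moreover have "{n..<g0 n} \<subseteq> {n..<g n}" using g(3)[of n] by auto
    ultimately show False using * by blast
  qed
  ultimately show thesis using that[OF f(1)] infinite_super by blast
qed

text \<open>The members of \<open>E\<close> are unions of blocks: the partition comes from an
  unbounded family, the set of block indices from a splitting family. The indices of blocks that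
  meet all relevant terms form an infinite set; splitting it splits every infinite term at once. The
  assumption bounds the number of such pairs by \<bb>.\<close>

lemma sequence_splitting_family:
  assumes "\<ss> \<le>o \<bb>"
  obtains E where "|E| \<le>o \<bb>"
    "\<And>Q. big Q \<Longrightarrow> \<exists>e\<in>E. big (\<lambda>n. Q n \<inter> e) \<and> big (\<lambda>n. Q n - e)"
proof -
  obtain B where B: "unbounded_family B" "|B| = \<bb>" by (rule bounding_number_witness)
  obtain E0 where E0: "splitting_family E0" "|E0| = \<ss>"
    using least_size_works[of "{E. splitting_family E}"] splitting_family_infinite_sets
    unfolding splitting_number_def by blast
  let ?p = "\<lambda>f. iterates (monotone_majorant f)"
  have p: "strict_mono (?p f)" for f
    by (intro strict_mono_iterates monotone_majorant)
  define u where "u f e = (\<Union>k\<in>e. block (?p f) k)" for f e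
  define E where "E = (\<lambda>(f, e). u f e) ` (B \<times> E0)"
  have "infinite B"
  proof
    assume "finite B"
    then have "countable B" by (rule countable_finite)
    then show False
      using B(1) dominated_if_countable unfolding unbounded_family_def by metis
  qed
  have "|E| \<le>o |B \<times> E0|" unfolding E_def by (rule card_of_image)
  also have "|B \<times> E0| \<le>o |B|"
  proof -
    have "|E0| \<le>o |B|" using assms B(2) E0(2) by simp
    then show ?thesis 
      using \<open>infinite B\<close> card_of_refl ordIso_imp_ordLeq
      by (intro card_of_Sigma_ordLeq_infinite) blast+
  qed
  finally have "|E| \<le>o \<bb>" using B(2) by simp
  moreover have "\<exists>e\<in>E. big (\<lambda>n. Q n \<inter> e) \<and> big (\<lambda>n. Q n - e)" if "big Q" for Q
  proof -
    obtain f where f: "f \<in> B"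
      "infinite {k. \<forall>i\<le>k. infinite (Q i) \<longrightarrow> Q i \<inter> block (?p f) k \<noteq> {}}" (is "infinite ?X")
      using infinite_blocks_meeting[OF B(1)] by blast
    obtain e where e: "e \<in> E0" "infinite (?X \<inter> e)" "infinite (?X \<inter> (UNIV - e))"
      using E0(1) f(2) unfolding splitting_family_def by blast
    have in_u: "infinite (Q i \<inter> u f e)" if "infinite (Q i)" for i
    proof -
      have "infinite (Q i \<inter> (\<Union>k\<in>?X \<inter> e. block (?p f) k))"
        using that by (intro infinite_Int_union_of_blocks[OF p e(2)]) blast
      then show ?thesis unfolding u_def by (rule infinite_super[rotated]) blast
    qed
    have out_u: "infinite (Q i - u f e)" if "infinite (Q i)" for i
    proof -
      have "infinite (Q i \<inter> (\<Union>k\<in>?X \<inter> (UNIV - e). block (?p f) k))"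
        using that by (intro infinite_Int_union_of_blocks[OF p e(3)]) blast
      then show ?thesis
        unfolding u_def by (rule infinite_super[rotated]) (use disjoint_blocks[OF p] in blast)
    qed
    have "big (\<lambda>n. Q n \<inter> u f e)" "big (\<lambda>n. Q n - u f e)"
      using that in_u out_u unfolding big_def by (auto elim!: INFM_mono)
    moreover have "u f e \<in> E" unfolding E_def using f(1) e(1) by force
    ultimately show ?thesis by blast
  qed
  ultimately show thesis using that by blast
qed

section \<open>Types of sequences\<close>

definition splits :: "nat set \<Rightarrow> (nat \<Rightarrow> nat set) \<Rightarrow> bool" where
  "splits e Q \<longleftrightarrow> big (\<lambda>n. Q n \<inter> e) \<and> big (\<lambda>n. Q n - e)"

lemma splits_mono:
  assumes "splits e R" "\<forall>\<^sub>\<infinity>n. R n \<subseteq> Q n"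
  shows "splits e Q"
proof -
  have R: "big (\<lambda>n. R n \<inter> e)" "big (\<lambda>n. R n - e)"
    using assms(1) unfolding splits_def by auto
  have "\<forall>\<^sub>\<infinity>n. R n \<inter> e \<subseteq> Q n \<inter> e" "\<forall>\<^sub>\<infinity>n. R n - e \<subseteq> Q n - e"
    using assms(2) by (auto elim: MOST_mono)
  then show ?thesis
    unfolding splits_def by (intro conjI big_mono[OF R(1)] big_mono[OF R(2)])
qed

text \<open>Choose increasing indices \<open>k m\<close> with \<open>Q m (k m)\<close> infinite.
  \<open>R\<close> keeps just these sets at these indices and is empty elsewhere, so from
  \<open>k m\<close> on it lies inside \<open>Q m\<close>.\<close>

lemma fusion:
  fixes Q :: "nat \<Rightarrow> nat \<Rightarrow> nat set"
  assumes big: "\<And>m. big (Q m)" and dec: "\<And>m n. Q (Suc m) n \<subseteq> Q m n"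
  obtains R where "big R" "\<And>n. R n \<subseteq> Q 0 n" "\<And>m. \<forall>\<^sub>\<infinity>n. R n \<subseteq> Q m n"
proof -
  have "\<exists>k. \<forall>m. infinite (Q m (k m)) \<and> k m < k (Suc m)"
  proof (intro dependent_nat_choice)
    show "\<exists>k. infinite (Q 0 k)"
      using big[of 0] unfolding big_def INFM_nat by blast
    show "\<exists>k'. infinite (Q (Suc m) k') \<and> k < k'" for k m
      using big[of "Suc m"] unfolding big_def INFM_nat by blast
  qed
  then obtain k where k: "\<And>m. infinite (Q m (k m))" "strict_mono k"
    by (auto simp: strict_mono_Suc_iff)
  have Q_anti: "Q m n \<subseteq> Q l n" if "l \<le> m" for l m n
    using lift_Suc_antimono_le[of "\<lambda>m. Q m n"] dec that by blast
  define R where "R n = (\<Union>m\<in>{m. k m = n}. Q m n)" for n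
  have R_sub: "R n \<subseteq> Q m n" if "k m \<le> n" for m n
    unfolding R_def using that k(2) Q_anti by (fastforce simp: strict_mono_less_eq)
  have "big R"
    unfolding big_def INFM_nat_le
  proof
    fix m
    have "Q m (k m) \<subseteq> R (k m)" unfolding R_def by blast
    then have "infinite (R (k m))" using k(1) finite_subset by blast
    then show "\<exists>n\<ge>m. infinite (R n)"
      using strict_mono_imp_increasing[OF k(2)] by blast
  qed
  moreover have "R n \<subseteq> Q 0 n" for n
    unfolding R_def using Q_anti by blast
  moreover have "\<forall>\<^sub>\<infinity>n. R n \<subseteq> Q m n" for m
    unfolding MOST_nat_le using R_sub by blast
  ultimately show thesis by (rule that)
qed

type_synonym node = "nat set \<times> nat set set"

definition side :: "nat set set \<Rightarrow> nat set \<Rightarrow> nat set" where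
  "side H e = (if e \<in> H then e else - e)"

locale splitting_tree =
  fixes E :: "nat set set"
  assumes small: "|E| \<le>o \<bb>"
    and split: "big Q \<Longrightarrow> \<exists>e\<in>E. splits e Q"
begin

text \<open>A node \<open>(\<alpha>, H)\<close> stands for the branch of length \<open>\<alpha>\<close> that chooses the side \<open>e\<close> for \<open>e \<in> H\<close>
  and the side \<open>- e\<close> for the other \<open>e\<close> below \<open>\<alpha>\<close>, in a well-order of \<open>E\<close> of minimal length.\<close>

definition below :: "nat set \<Rightarrow> nat set set" where
  "below \<alpha> = underS |E| \<alpha>"

definition nodes :: "node set" where
  "nodes = {(\<alpha>, H). \<alpha> \<in> E \<and> H \<subseteq> below \<alpha>}"

definition incompatible :: "node \<Rightarrow> node \<Rightarrow> bool" where
  "incompatible \<sigma> \<tau> \<longleftrightarrow> (\<exists>e\<in>below (fst \<sigma>) \<inter> below (fst \<tau>). (e \<in> snd \<sigma>) \<noteq> (e \<in> snd \<tau>))"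

definition initial :: "node \<Rightarrow> node \<Rightarrow> bool"  (infix "\<sqsubseteq>" 50) where
  "\<sigma> \<sqsubseteq> \<tau> \<longleftrightarrow> below (fst \<sigma>) \<subseteq> below (fst \<tau>) \<and> snd \<sigma> \<inter> below (fst \<sigma>) = snd \<tau> \<inter> below (fst \<sigma>)"

definition homogeneous :: "nat set \<Rightarrow> node \<Rightarrow> bool" where
  "homogeneous c \<tau> \<longleftrightarrow> (\<forall>e\<in>below (fst \<tau>). finite (c - side (snd \<tau>) e))"

text \<open>Weaker than homogeneity of the terms: each \<open>e\<close> may fail at finitely many
  indices. In \<open>tails\<close> one function cuts the terms so that, for each \<open>e\<close>,
  almost all of them lie inside the side.\<close>

definition seq_homogeneous :: "(nat \<Rightarrow> nat set) \<Rightarrow> node \<Rightarrow> bool" where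
  "seq_homogeneous Q \<tau> \<longleftrightarrow> (\<forall>e\<in>below (fst \<tau>). \<forall>\<^sub>\<infinity>n. finite (Q n - side (snd \<tau>) e))"

section \<open>Order and compatibility of nodes\<close>

lemma below_subset: "below \<alpha> \<subseteq> E"
  unfolding below_def using Order_Relation.underS_Field[of "|E|" \<alpha>] by (simp add: Field_card_of)

text \<open>\<open>|E|\<close> is a well-order of minimal length, so its proper initial segments are
  smaller than \<open>E\<close> and hence than \<bb>.\<close>

lemma below_less: "\<alpha> \<in> E \<Longrightarrow> |below \<alpha>| <o \<bb>"
  unfolding below_def
  using card_of_underS[OF card_of_Card_order, of \<alpha> E] small
  by (simp add: Field_card_of ordLess_ordLeq_trans)

lemma below_linear:
  assumes "\<alpha> \<in> E" "\<beta> \<in> E"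
  shows "\<alpha> = \<beta> \<or> \<alpha> \<in> below \<beta> \<or> \<beta> \<in> below \<alpha>"
  using card_of_Well_order[of E] assms
  unfolding below_def underS_def well_order_on_def linear_order_on_def total_on_def
  by (auto simp: Field_card_of)

lemma below_trans: "\<beta> \<in> below \<alpha> \<Longrightarrow> below \<beta> \<subseteq> below \<alpha>"
  using card_of_Well_order[of E]
  unfolding below_def underS_def well_order_on_def linear_order_on_def partial_order_on_def
    preorder_on_def by (auto dest: transD antisymD)

lemma below_minimal:
  assumes "e \<in> E" "P e"
  obtains \<alpha> where "\<alpha> \<in> E" "P \<alpha>" "\<And>\<beta>. \<beta> \<in> below \<alpha> \<Longrightarrow> \<not> P \<beta>"
proof -
  have "wf ( |E| - Id)" using card_of_Well_order[of E] by (simp add: well_order_on_def)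
  then obtain \<alpha> where \<alpha>: "\<alpha> \<in> {\<alpha> \<in> E. P \<alpha>}"
    "\<And>\<beta>. (\<beta>, \<alpha>) \<in> |E| - Id \<Longrightarrow> \<beta> \<notin> {\<alpha> \<in> E. P \<alpha>}"
    using assms by (elim wfE_min[of _ e "{\<alpha> \<in> E. P \<alpha>}"]) auto
  show thesis
  proof (rule that)
    show "\<not> P \<beta>" if \<beta>: "\<beta> \<in> below \<alpha>" for \<beta>
      using \<alpha>(2)[of \<beta>] below_subset[of \<alpha>] \<beta> unfolding below_def underS_def by blast
  qed (use \<alpha>(1) in auto)
qed

text \<open>By linearity, nodes that agree on their common part are comparable, and one direction is
  excluded. The second conclusion recovers \<sigma> from its length and \<tau>, so \<tau> has only
  one such segment of each length.\<close>

lemma compatible_cases: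
  assumes "\<sigma> \<in> nodes" "\<tau> \<in> nodes" "\<not> incompatible \<sigma> \<tau>" "\<not> \<tau> \<sqsubseteq> \<sigma>"
  shows "fst \<sigma> \<in> below (fst \<tau>)" "\<sigma> = (fst \<sigma>, snd \<tau> \<inter> below (fst \<sigma>))"
proof -
  have E: "fst \<sigma> \<in> E" "fst \<tau> \<in> E" and sub: "snd \<sigma> \<subseteq> below (fst \<sigma>)"
    using assms(1,2) unfolding nodes_def by auto
  have agree: "e \<in> snd \<sigma> \<longleftrightarrow> e \<in> snd \<tau>" if "e \<in> below (fst \<sigma>)" "e \<in> below (fst \<tau>)" for e
    using assms(3) that unfolding incompatible_def by blast
  have "\<not> below (fst \<tau>) \<subseteq> below (fst \<sigma>)"
  proof
    assume "below (fst \<tau>) \<subseteq> below (fst \<sigma>)"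
    then have "\<tau> \<sqsubseteq> \<sigma>" using agree unfolding initial_def by blast
    with assms(4) show False ..
  qed
  then show *: "fst \<sigma> \<in> below (fst \<tau>)"
    using below_linear[OF E] below_trans[of "fst \<tau>" "fst \<sigma>"] by auto
  have "snd \<sigma> = snd \<tau> \<inter> below (fst \<sigma>)"
    using agree sub below_trans[OF *] by blast
  then show "\<sigma> = (fst \<sigma>, snd \<tau> \<inter> below (fst \<sigma>))" by (simp add: prod_eq_iff)
qed

lemma initial_same:
  assumes "\<sigma> \<sqsubseteq> \<rho>" "\<tau> \<sqsubseteq> \<rho>"
  shows "\<not> incompatible \<sigma> \<tau>"
  using assms unfolding initial_def incompatible_def by blast

lemma initial_refl: "\<sigma> \<sqsubseteq> \<sigma>"
  unfolding initial_def by simp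

lemma incompatible_sides:
  assumes "incompatible \<sigma> \<tau>"
  obtains e where "e \<in> below (fst \<sigma>)" "e \<in> below (fst \<tau>)" "side (snd \<sigma>) e \<inter> side (snd \<tau>) e = {}"
proof -
  obtain e where e: "e \<in> below (fst \<sigma>)" "e \<in> below (fst \<tau>)" "(e \<in> snd \<sigma>) \<noteq> (e \<in> snd \<tau>)"
    using assms unfolding incompatible_def by blast
  then have "side (snd \<sigma>) e \<inter> side (snd \<tau>) e = {}" unfolding side_def by auto
  with e(1,2) show thesis by (rule that)
qed

text \<open>Where the nodes differ their sides are complementary, so two finite differences cover
  the intersection.\<close>

lemma incompatible_homogeneous:
  assumes "incompatible \<sigma> \<tau>" "homogeneous c \<sigma>" "homogeneous d \<tau>"
  shows "finite (c \<inter> d)"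
proof -
  obtain e where e: "e \<in> below (fst \<sigma>)" "e \<in> below (fst \<tau>)"
    "side (snd \<sigma>) e \<inter> side (snd \<tau>) e = {}"
    using incompatible_sides[OF assms(1)] .
  have "c \<inter> d \<subseteq> (c - side (snd \<sigma>) e) \<union> (d - side (snd \<tau>) e)" using e(3) by blast
  then show ?thesis
    using assms(2,3) e(1,2) unfolding homogeneous_def
    by (meson finite_UnI finite_subset)
qed

section \<open>Types of big sequences and the binary tree of refinements\<close>

definition pivot :: "(nat \<Rightarrow> nat set) \<Rightarrow> nat set" where
  "pivot Q = (SOME \<alpha>. \<alpha> \<in> E \<and> splits \<alpha> Q \<and> (\<forall>\<beta>\<in>below \<alpha>. \<not> splits \<beta> Q))"

text \<open>Below the pivot no \<open>e\<close> splits a big \<open>Q\<close>, so exactly one of the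
  two parts of \<open>Q\<close> is big; the node records its side.\<close>

definition type_of :: "(nat \<Rightarrow> nat set) \<Rightarrow> node" where
  "type_of Q = (pivot Q, {e \<in> below (pivot Q). big (\<lambda>n. Q n \<inter> e)})"

lemma pivot:
  assumes "big Q"
  shows "pivot Q \<in> E" "splits (pivot Q) Q" "\<And>\<beta>. \<beta> \<in> below (pivot Q) \<Longrightarrow> \<not> splits \<beta> Q"
proof -
  obtain e where e: "e \<in> E" "splits e Q" using split[OF assms] by blast
  obtain \<alpha> where "\<alpha> \<in> E" "splits \<alpha> Q" "\<And>\<beta>. \<beta> \<in> below \<alpha> \<Longrightarrow> \<not> splits \<beta> Q"
    using below_minimal[of e "\<lambda>e. splits e Q", OF e] by blast
  then have "\<exists>\<alpha>. \<alpha> \<in> E \<and> splits \<alpha> Q \<and> (\<forall>\<beta>\<in>below \<alpha>. \<not> splits \<beta> Q)" by blast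
  from someI_ex[OF this]
  show "pivot Q \<in> E" "splits (pivot Q) Q" "\<And>\<beta>. \<beta> \<in> below (pivot Q) \<Longrightarrow> \<not> splits \<beta> Q"
    unfolding pivot_def by blast+
qed

lemma type_of_node: "big Q \<Longrightarrow> type_of Q \<in> nodes"
  unfolding type_of_def nodes_def using pivot(1) by auto

lemma seq_homogeneous_type_of:
  assumes "big Q"
  shows "seq_homogeneous Q (type_of Q)"
  unfolding seq_homogeneous_def
proof
  fix e assume "e \<in> below (fst (type_of Q))"
  then have e: "e \<in> below (pivot Q)" unfolding type_of_def by simp
  have ns: "\<not> splits e Q" by (rule pivot(3)[OF assms e])
  show "\<forall>\<^sub>\<infinity>n. finite (Q n - side (snd (type_of Q)) e)"
  proof (cases "big (\<lambda>n. Q n \<inter> e)")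
    case True
    then have "\<not> big (\<lambda>n. Q n - e)" using ns unfolding splits_def by blast
    then show ?thesis
      using True e unfolding not_big_iff type_of_def side_def by simp
  next
    case False
    then have "side (snd (type_of Q)) e = - e" unfolding type_of_def side_def by simp
    with False show ?thesis unfolding not_big_iff by (simp add: Diff_eq)
  qed
qed

text \<open>Whatever splits \<open>R\<close> also splits \<open>Q\<close>, so refining never lowers
  the pivot; it moves strictly up once the old pivot stops splitting.\<close>

lemma pivot_below_refinement:
  assumes "big Q" "big R" "\<forall>\<^sub>\<infinity>n. R n \<subseteq> Q n" "\<not> splits (pivot Q) R"
  shows "pivot Q \<in> below (pivot R)"
proof -
  have "pivot R \<noteq> pivot Q" using assms(4) pivot(2)[OF assms(2)] by metis
  moreover have "pivot R \<notin> below (pivot Q)"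
    using pivot(3)[OF assms(1)] splits_mono[OF pivot(2)[OF assms(2)] assms(3)] by blast
  ultimately show ?thesis
    using below_linear[OF pivot(1)[OF assms(1)] pivot(1)[OF assms(2)]] by metis
qed

text \<open>The set \<open>f\<close> codes a path through a binary tree: at stage \<open>m\<close>
  the current sequence is cut by its own pivot, and membership of \<open>m\<close> in
  \<open>f\<close> selects the half.\<close>

primrec branch :: "(nat \<Rightarrow> nat set) \<Rightarrow> nat set \<Rightarrow> nat \<Rightarrow> nat \<Rightarrow> nat set" where
  "branch Q f 0 = Q"
| "branch Q f (Suc m) = (\<lambda>n. if m \<in> f then branch Q f m n \<inter> pivot (branch Q f m)
     else branch Q f m n - pivot (branch Q f m))"

lemma big_branch:
  assumes "big Q"
  shows "big (branch Q f m)"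
proof (induction m)
  case (Suc m)
  then show ?case using pivot(2)[OF Suc] unfolding splits_def by (cases "m \<in> f") auto
qed (simp add: assms)

lemma branch_cong: "(\<And>i. i < m \<Longrightarrow> i \<in> f \<longleftrightarrow> i \<in> g) \<Longrightarrow> branch Q f m = branch Q g m"
proof (induction m)
  case (Suc m)
  then have "branch Q f m = branch Q g m" "m \<in> f \<longleftrightarrow> m \<in> g" by auto
  then show ?case by (metis branch.simps(2))
qed simp

text \<open>Up to \<open>m\<close> both paths run through the same sequence. Its pivot splits
  neither \<open>R\<close> nor \<open>S\<close>, so it lies below both new pivots, and there the two
  types choose opposite sides.\<close>

lemma incompatible_branches:
  assumes "big Q" and Rf: "big R" "\<And>m. \<forall>\<^sub>\<infinity>n. R n \<subseteq> branch Q f m n"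
    and Rg: "big S" "\<And>m. \<forall>\<^sub>\<infinity>n. S n \<subseteq> branch Q g m n"
    and m: "\<And>i. i < m \<Longrightarrow> i \<in> f \<longleftrightarrow> i \<in> g" and fg: "m \<in> f" "m \<notin> g"
  shows "incompatible (type_of R) (type_of S)"
proof -
  let ?U = "branch Q f m"
  let ?p = "pivot ?U"
  have U: "big ?U" by (rule big_branch[OF assms(1)])
  have gm: "branch Q g m = ?U" using branch_cong[OF m] by simp
  have R: "\<forall>\<^sub>\<infinity>n. R n \<subseteq> ?U n \<inter> ?p" using Rf(2)[of "Suc m"] fg(1) by simp
  have S: "\<forall>\<^sub>\<infinity>n. S n \<subseteq> ?U n - ?p" using Rg(2)[of "Suc m"] fg(2) gm by simp
  have "\<forall>\<^sub>\<infinity>n. finite (R n - ?p)"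
    using R by (rule MOST_mono) (metis Diff_eq_empty_iff finite.emptyI le_infE)
  then have "\<not> splits ?p R" unfolding splits_def using not_big_iff by blast
  then have pR: "?p \<in> below (pivot R)"
    by (rule pivot_below_refinement[OF U Rf(1) Rf(2)])
  have fin: "\<forall>\<^sub>\<infinity>n. finite (S n \<inter> ?p)"
    using S
  proof (rule MOST_mono)
    fix n assume "S n \<subseteq> ?U n - ?p"
    then have "S n \<inter> ?p = {}" by blast
    then show "finite (S n \<inter> ?p)" by simp
  qed
  then have "\<not> splits ?p S" unfolding splits_def using not_big_iff by blast
  then have pS: "?p \<in> below (pivot S)"
    by (rule pivot_below_refinement[OF U Rg(1) Rg(2)[of m, unfolded gm]])
  have "\<forall>\<^sub>\<infinity>n. R n \<subseteq> R n \<inter> ?p" using R by (rule MOST_mono) blast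
  then have "big (\<lambda>n. R n \<inter> ?p)" by (rule big_mono[OF Rf(1)])
  moreover have "\<not> big (\<lambda>n. S n \<inter> ?p)" using fin not_big_iff by blast
  ultimately show ?thesis
    using pR pS unfolding incompatible_def type_of_def by auto
qed

lemma incompatible_sym: "incompatible \<sigma> \<tau> \<Longrightarrow> incompatible \<tau> \<sigma>"
  unfolding incompatible_def by blast

text \<open>Each path is fused into one sequence; two paths are compared at their first
  difference.\<close>

lemma incompatible_refinements:
  assumes "big Q"
  obtains R :: "nat set \<Rightarrow> nat \<Rightarrow> nat set"
  where "\<And>f. big (R f)" "\<And>f n. R f n \<subseteq> Q n"
    "\<And>f g. f \<noteq> g \<Longrightarrow> incompatible (type_of (R f)) (type_of (R g))"
proof -
  have "\<exists>R. big R \<and> (\<forall>n. R n \<subseteq> Q n) \<and> (\<forall>m. \<forall>\<^sub>\<infinity>n. R n \<subseteq> branch Q f m n)" for f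
  proof -
    obtain R where "big R" "\<And>n. R n \<subseteq> branch Q f 0 n" "\<And>m. \<forall>\<^sub>\<infinity>n. R n \<subseteq> branch Q f m n"
      by (rule fusion[of "branch Q f"]) (auto intro: big_branch[OF assms])
    then show ?thesis by auto
  qed
  then obtain R where R: "\<And>f. big (R f)" "\<And>f n. R f n \<subseteq> Q n"
    "\<And>f m. \<forall>\<^sub>\<infinity>n. R f n \<subseteq> branch Q f m n" by metis
  have "incompatible (type_of (R f)) (type_of (R g))" if fg: "f \<noteq> g" for f g
  proof -
    define m where "m = (LEAST m. (m \<in> f) \<noteq> (m \<in> g))"
    have "\<exists>m. (m \<in> f) \<noteq> (m \<in> g)" using fg by auto
    then have m: "(m \<in> f) \<noteq> (m \<in> g)" unfolding m_def by (rule LeastI_ex)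
    have less: "i \<in> f \<longleftrightarrow> i \<in> g" if "i < m" for i
      using not_less_Least[of i "\<lambda>m. (m \<in> f) \<noteq> (m \<in> g)"] that unfolding m_def by blast
    show ?thesis
    proof (cases "m \<in> f")
      case True
      then show ?thesis
        using incompatible_branches[OF assms R(1) R(3) R(1) R(3), of m f g] m less by blast
    next
      case False
      then show ?thesis
        using incompatible_branches[OF assms R(1) R(3) R(1) R(3), of m g f] m less
          incompatible_sym by metis
    qed
  qed
  with R(1,2) show thesis by (rule that)
qed

text \<open>A counting argument: initial segments of one node are compatible, so if every refinement
  had a type below some member of \<open>W\<close>, distinct paths would need distinct members and
  \<open>W\<close> would be too large.\<close>

lemma homogeneous_refinement:
  assumes "big Q" and W: "|W| <o |UNIV :: nat set set|"
  obtains R \<tau> where "big R" "\<forall>n. R n \<subseteq> Q n" "\<tau> \<in> nodes" "seq_homogeneous R \<tau>"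
    "\<forall>w\<in>W. \<not> \<tau> \<sqsubseteq> w"
proof -
  obtain R :: "nat set \<Rightarrow> nat \<Rightarrow> nat set"
  where R: "\<And>f. big (R f)" "\<And>f n. R f n \<subseteq> Q n"
    "\<And>f g. f \<noteq> g \<Longrightarrow> incompatible (type_of (R f)) (type_of (R g))"
    using incompatible_refinements[OF assms(1)] by blast
  have "\<exists>f. \<forall>w\<in>W. \<not> type_of (R f) \<sqsubseteq> w"
  proof (rule ccontr)
    assume "\<not> ?thesis"
    then obtain w where w: "\<And>f. w f \<in> W" "\<And>f. type_of (R f) \<sqsubseteq> w f" by metis
    have "inj w"
    proof (rule injI, rule ccontr)
      fix f g assume "w f = w g" "f \<noteq> g"
      then show False using R(3) initial_same w(2) by metis
    qed
    then have "|UNIV :: nat set set| \<le>o |W|"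
      using w(1) by (intro card_of_ordLeqI) auto
    with W show False using not_ordLess_ordLeq by blast
  qed
  then obtain f where f: "\<And>w. w \<in> W \<Longrightarrow> \<not> type_of (R f) \<sqsubseteq> w" by blast
  show thesis
    by (rule that[of "R f" "type_of (R f)"])
      (use R f type_of_node seq_homogeneous_type_of in auto)
qed

end

section \<open>Extending an almost disjoint family\<close>

lemma natLeq_less_nat_sets: "natLeq <o |UNIV :: nat set set|"
  using ordIso_ordLess_trans[OF ordIso_symmetric[OF card_of_nat] card_of_Pow[of "UNIV :: nat set"]]
  by simp

lemma countable_less_nat_sets: "countable A \<Longrightarrow> |A| <o |UNIV :: nat set set|"
  unfolding countable_card_le_natLeq by (rule ordLeq_ordLess_trans[OF _ natLeq_less_nat_sets])

context splitting_tree
begin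

text \<open>A member \<open>a\<close> of the family cannot be made homogeneous itself, since it is a union of pieces of
  different nodes. The countable set \<open>Z\<close> of these nodes, together with the node of the sequence of
  pieces, guards \<open>a\<close> against homogeneous sets.\<close>

definition guarded :: "nat set \<Rightarrow> node set \<Rightarrow> bool" where
  "guarded a Z \<longleftrightarrow> (\<forall>c \<rho>. homogeneous c \<rho> \<and> (\<forall>z\<in>Z. incompatible z \<rho>) \<longrightarrow> finite (a \<inter> c))"

definition admissible :: "nat set \<times> node set \<Rightarrow> bool" where
  "admissible p \<longleftrightarrow> infinite (fst p) \<and> countable (snd p) \<and> snd p \<subseteq> nodes \<and> guarded (fst p) (snd p)"

definition used :: "(nat set \<times> node set) set \<Rightarrow> node set" where
  "used S = (\<Union>p\<in>S. snd p)"

text \<open>A node may occur in countably many members, not just one, because the nodes of the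
  countable initial system are chosen independently. This makes \<open>F e\<close> countable in
  \<open>tails\<close>.\<close>

definition system :: "(nat set \<times> node set) set \<Rightarrow> bool" where
  "system S \<longleftrightarrow> (\<forall>p\<in>S. admissible p) \<and> (\<forall>p\<in>S. \<forall>q\<in>S. p \<noteq> q \<longrightarrow> finite (fst p \<inter> fst q)) \<and>
     (\<forall>z. countable {p \<in> S. z \<in> snd p})"

text \<open>Avoiding \<open>used S\<close> guarantees that no two members added in the recursion
  carry a common node.\<close>

definition fresh :: "(nat set \<times> node set) set \<Rightarrow> nat set \<times> node set \<Rightarrow> bool" where
  "fresh S p \<longleftrightarrow> admissible p \<and> (\<forall>q\<in>S. finite (fst q \<inter> fst p)) \<and> snd p \<inter> used S = {}"

lemma system_admissible: "system S \<Longrightarrow> p \<in> S \<Longrightarrow> admissible p"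
  unfolding system_def by simp

lemma system_almost_disjoint:
  "system S \<Longrightarrow> p \<in> S \<Longrightarrow> q \<in> S \<Longrightarrow> p \<noteq> q \<Longrightarrow> finite (fst p \<inter> fst q)"
  unfolding system_def by simp

lemma guardedD:
  "guarded a Z \<Longrightarrow> homogeneous c \<rho> \<Longrightarrow> \<forall>z\<in>Z. incompatible z \<rho> \<Longrightarrow> finite (a \<inter> c)"
  unfolding guarded_def by blast

lemma used_small:
  assumes "system S" "|S| <o |UNIV :: nat set set|"
  shows "|used S| <o |UNIV :: nat set set|"
proof (cases "finite S")
  case True
  then have "countable (used S)"
    using system_admissible[OF assms(1)] True unfolding used_def admissible_def
    by (auto intro: countable_finite)
  then show ?thesis by (rule countable_less_nat_sets)
next
  case False
  then have "natLeq \<le>o |S|" using infinite_iff_natLeq_ordLeq[of S] by blast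
  then have "|snd p| \<le>o |S|" if "p \<in> S" for p
    using system_admissible[OF assms(1) that] ordLeq_transitive
    unfolding admissible_def countable_card_le_natLeq by blast
  then have "|used S| \<le>o |S|"
    unfolding used_def using False card_of_refl ordIso_imp_ordLeq
    by (intro card_of_UNION_ordLeq_infinite ballI) blast+
  then show ?thesis using assms(2) by (rule ordLeq_ordLess_trans)
qed

text \<open>A node that is compatible with \<open>\<tau>\<close> but does not extend it is an initial segment of \<open>\<tau>\<close>, so
  there are fewer than \<open>\<bb>\<close> of these. Hence one function \<open>g\<close> takes care of all of them.\<close>

lemma tails:
  assumes S: "system S" and \<tau>: "\<tau> \<in> nodes" "seq_homogeneous R \<tau>"
    and new: "\<forall>w\<in>used S. \<not> \<tau> \<sqsubseteq> w"
    and fin: "\<forall>p\<in>S. \<forall>\<^sub>\<infinity>j. finite (fst p \<inter> R j)"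
  shows "\<exists>g. (\<forall>e\<in>below (fst \<tau>). \<forall>\<^sub>\<infinity>j. R j \<inter> {g j..} \<subseteq> side (snd \<tau>) e) \<and>
    (\<forall>p\<in>S. \<forall>z\<in>snd p. \<not> incompatible z \<tau> \<longrightarrow> (\<forall>\<^sub>\<infinity>j. R j \<inter> {g j..} \<inter> fst p = {}))"
proof -
  \<comment> \<open>The requirements at length \<open>e\<close>: stay on the side that \<tau>
    chooses at \<open>e\<close>, and avoid all members that carry the initial segment of \<tau> of
    length \<open>e\<close>.\<close>
  define F where "F e = insert (\<lambda>j. R j - side (snd \<tau>) e)
    ((\<lambda>p j. fst p \<inter> R j) ` {p \<in> S. (e, snd \<tau> \<inter> below e) \<in> snd p})" for e
  have "fst \<tau> \<in> E" using \<tau>(1) unfolding nodes_def by auto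
  then have *: "|below (fst \<tau>)| <o \<bb>" by (rule below_less)
  have countable: "countable (F e)" for e
    using S unfolding F_def system_def by simp
  have finite: "\<forall>\<^sub>\<infinity>j. finite (X j)" if "e \<in> below (fst \<tau>)" "X \<in> F e" for e X
    using that \<tau>(2) fin unfolding F_def seq_homogeneous_def by auto
  have "\<exists>g. \<forall>e\<in>below (fst \<tau>). \<forall>X\<in>F e. \<forall>\<^sub>\<infinity>j. X j \<inter> {g j..} = {}"
    using * countable finite by (rule eventually_avoid)
  then obtain g where "\<forall>e\<in>below (fst \<tau>). \<forall>X\<in>F e. \<forall>\<^sub>\<infinity>j. X j \<inter> {g j..} = {}" by (elim exE)
  then have g: "\<forall>\<^sub>\<infinity>j. X j \<inter> {g j..} = {}" if "e \<in> below (fst \<tau>)" "X \<in> F e" for e X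
    using that by blast
  show ?thesis
  proof (intro exI conjI ballI impI)
    fix e assume e: "e \<in> below (fst \<tau>)"
    have "\<forall>\<^sub>\<infinity>j. (R j - side (snd \<tau>) e) \<inter> {g j..} = {}"
      by (rule g[OF e]) (simp add: F_def)
    then show "\<forall>\<^sub>\<infinity>j. R j \<inter> {g j..} \<subseteq> side (snd \<tau>) e"
      by (rule MOST_mono) blast
  next
    fix p z assume p: "p \<in> S" "z \<in> snd p" and "\<not> incompatible z \<tau>"
    moreover have "z \<in> nodes"
      using system_admissible[OF S p(1)] p(2) unfolding admissible_def by blast
    moreover have "\<not> \<tau> \<sqsubseteq> z" using p new unfolding used_def by blast
    ultimately have z: "fst z \<in> below (fst \<tau>)" "z = (fst z, snd \<tau> \<inter> below (fst z))"
      using compatible_cases \<tau>(1) by blast+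
    have "(\<lambda>j. fst p \<inter> R j) \<in> F (fst z)"
      unfolding F_def using p z(2) by auto
    then have "\<forall>\<^sub>\<infinity>j. (fst p \<inter> R j) \<inter> {g j..} = {}" by (rule g[OF z(1)])
    then show "\<forall>\<^sub>\<infinity>j. R j \<inter> {g j..} \<inter> fst p = {}" by (simp add: Int_ac)
  qed
qed

text \<open>If finitely many members meet \<open>b\<close> in an infinite set, removing them leaves
  an infinite set by positivity, and a constant sequence works. Otherwise the pieces are the
  intersections of \<open>b\<close> with infinitely many such members; a member can have infinite
  intersection only with the piece that it cuts out itself.\<close>

lemma almost_disjoint_pieces:
  assumes S: "system S" and b: "b \<in> \<I>\<^sup>+ (fst ` S)"
  obtains Q where "\<forall>j::nat. infinite (Q j)" "\<forall>j. Q j \<subseteq> b"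
    "\<forall>p\<in>S. \<forall>\<^sub>\<infinity>j. finite (fst p \<inter> Q j)"
proof (cases "finite {p \<in> S. infinite (fst p \<inter> b)}")
  case True
  let ?P = "{p \<in> S. infinite (fst p \<inter> b)}"
  let ?c = "b - \<Union>(fst ` ?P)"
  have P: "finite (fst ` ?P)" "fst ` ?P \<subseteq> fst ` S" using True by auto
  have "infinite ?c"
  proof
    assume "finite ?c"
    with P have "b \<in> \<I> (fst ` S)"
      unfolding mem_generated_ideal_iff by (intro exI[of _ "fst ` ?P"] conjI)
    then show False using b unfolding positive_sets_def by simp
  qed
  moreover have "finite (fst p \<inter> ?c)" if "p \<in> S" for p
  proof (cases "p \<in> ?P")
    case True
    then have "fst p \<inter> ?c = {}" by blast
    then show ?thesis by simp
  next
    case False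
    then have "finite (fst p \<inter> b)" using that by blast
    then show ?thesis by (rule rev_finite_subset) blast
  qed
  ultimately show thesis by (intro that[of "\<lambda>_. ?c"]) auto
next
  case False
  then obtain h :: "nat \<Rightarrow> nat set \<times> node set"
    where h: "inj h" "range h \<subseteq> {p \<in> S. infinite (fst p \<inter> b)}"
    using infinite_countable_subset[OF False] by (elim exE conjE)
  have "\<forall>\<^sub>\<infinity>j. finite (fst p \<inter> (b \<inter> fst (h j)))" if p: "p \<in> S" for p
  proof -
    have "finite (h -` {p})" using h(1) by (intro finite_vimageI) auto
    then have "\<forall>\<^sub>\<infinity>j. h j \<noteq> p"
      unfolding MOST_iff_cofinite by (simp add: vimage_def)
    then show ?thesis
    proof (rule MOST_mono)
      fix j assume "h j \<noteq> p"
      moreover have "h j \<in> S" using h(2) by auto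
      ultimately have "finite (fst p \<inter> fst (h j))"
        using system_almost_disjoint[OF S p] by metis
      then show "finite (fst p \<inter> (b \<inter> fst (h j)))" by (rule rev_finite_subset) blast
    qed
  qed
  moreover have "infinite (b \<inter> fst (h j))" for j
    using h(2) by (auto simp: Int_commute)
  ultimately show thesis by (intro that[of "\<lambda>j. b \<inter> fst (h j)"]) auto
qed

text \<open>One point is taken from the tail of each infinite term of a homogeneous refinement.
  Members with a node compatible with \<tau> are avoided by the choice of tails, the others by their
  guard.\<close>

lemma homogeneous_subset:
  assumes S: "system S" and small: "|used S| <o |UNIV :: nat set set|"
    and b: "b \<in> \<I>\<^sup>+ (fst ` S)"
  shows "\<exists>c \<eta>. c \<subseteq> b \<and> infinite c \<and> \<eta> \<in> nodes \<and> homogeneous c \<eta> \<and>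
    (\<forall>p\<in>S. finite (fst p \<inter> c)) \<and> (\<forall>w\<in>used S. \<not> \<eta> \<sqsubseteq> w)"
proof -
  obtain Q where Q: "\<forall>j::nat. infinite (Q j)" "\<forall>j. Q j \<subseteq> b"
    "\<forall>p\<in>S. \<forall>\<^sub>\<infinity>j. finite (fst p \<inter> Q j)"
    by (rule almost_disjoint_pieces[OF S b])
  have "big Q" using Q(1) unfolding big_def by simp
  obtain R \<tau> where R: "big R" "\<forall>n. R n \<subseteq> Q n" "\<tau> \<in> nodes" "seq_homogeneous R \<tau>"
    "\<forall>w\<in>used S. \<not> \<tau> \<sqsubseteq> w"
    by (rule homogeneous_refinement[OF \<open>big Q\<close> small])
  have fin: "\<forall>p\<in>S. \<forall>\<^sub>\<infinity>j. finite (fst p \<inter> R j)"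
  proof (intro ballI, rule MOST_mono)
    fix p assume "p \<in> S"
    with Q(3) show "\<forall>\<^sub>\<infinity>j. finite (fst p \<inter> Q j)" by blast
  next
    fix p j assume "finite (fst p \<inter> Q j)"
    then show "finite (fst p \<inter> R j)" by (rule rev_finite_subset) (use R(2) in blast)
  qed
  note tails[OF S R(3,4,5) fin]
  then obtain g where g1: "\<forall>e\<in>below (fst \<tau>). \<forall>\<^sub>\<infinity>j. R j \<inter> {g j..} \<subseteq> side (snd \<tau>) e"
    and g2: "\<forall>p\<in>S. \<forall>z\<in>snd p. \<not> incompatible z \<tau> \<longrightarrow> (\<forall>\<^sub>\<infinity>j. R j \<inter> {g j..} \<inter> fst p = {})"
    by (elim exE conjE)
  define J where "J = {j. infinite (R j)}"
  have "infinite J"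
    using R(1) unfolding J_def big_def frequently_cofinite .
  \<comment> \<open>The bound \<open>g j\<close> puts the point into the tail; the bound
    \<open>j\<close> makes the set of points infinite.\<close>
  have "\<forall>j\<in>J. \<exists>x. x \<in> R j \<and> x \<ge> max (g j) j"
    unfolding J_def infinite_nat_iff_unbounded_le by blast
  from bchoice[OF this] obtain x where "\<forall>j\<in>J. x j \<in> R j \<and> x j \<ge> max (g j) j" by (elim exE)
  then have x: "\<And>j. j \<in> J \<Longrightarrow> x j \<in> R j" "\<And>j. j \<in> J \<Longrightarrow> x j \<ge> g j"
    "\<And>j. j \<in> J \<Longrightarrow> x j \<ge> j"
    by simp_all
  define c where "c = x ` J"
  \<comment> \<open>Each exceptional index costs at most one point.\<close>
  have almost: "finite (c \<inter> A)" if ev: "\<forall>\<^sub>\<infinity>j. R j \<inter> {g j..} \<inter> A = {}" for A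
  proof -
    obtain m where m: "\<And>j. j \<ge> m \<Longrightarrow> R j \<inter> {g j..} \<inter> A = {}"
      using ev unfolding MOST_nat_le by blast
    have "c \<inter> A \<subseteq> x ` {..<m}"
    proof
      fix y assume "y \<in> c \<inter> A"
      then obtain j where j: "j \<in> J" "y = x j" "x j \<in> A" unfolding c_def by blast
      then have "x j \<in> R j \<inter> {g j..} \<inter> A" using x by simp
      then have "j < m" using m[of j] by (metis empty_iff not_le)
      then show "y \<in> x ` {..<m}" using j(2) by blast
    qed
    then show ?thesis by (rule finite_subset) simp
  qed
  have "infinite c"
    unfolding infinite_nat_iff_unbounded_le
  proof
    fix m
    obtain j where "j \<in> J" "j \<ge> m"
      using \<open>infinite J\<close> unfolding infinite_nat_iff_unbounded_le by blast
    then show "\<exists>n\<ge>m. n \<in> c" unfolding c_def using x(3) le_trans by blast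
  qed
  moreover have "c \<subseteq> b" unfolding c_def using x(1) R(2) Q(2) by blast
  moreover have hom: "homogeneous c \<tau>"
    unfolding homogeneous_def
  proof
    fix e assume "e \<in> below (fst \<tau>)"
    from bspec[OF g1 this] have "\<forall>\<^sub>\<infinity>j. R j \<inter> {g j..} \<inter> - side (snd \<tau>) e = {}"
      by (rule MOST_mono) blast
    then have "finite (c \<inter> - side (snd \<tau>) e)" by (rule almost)
    then show "finite (c - side (snd \<tau>) e)" by (simp add: Diff_eq)
  qed
  moreover have "finite (fst p \<inter> c)" if p: "p \<in> S" for p
  proof (cases "\<forall>z\<in>snd p. incompatible z \<tau>")
    case True
    then show ?thesis
      using system_admissible[OF S p] hom guardedD unfolding admissible_def by blast
  next
    case False
    then obtain z where "z \<in> snd p" "\<not> incompatible z \<tau>" by blast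
    with g2 p have "\<forall>\<^sub>\<infinity>j. R j \<inter> {g j..} \<inter> fst p = {}" by blast
    then have "finite (c \<inter> fst p)" by (rule almost)
    then show ?thesis by (simp add: Int_commute)
  qed
  ultimately show ?thesis using R(3,5) by blast
qed

text \<open>Homogeneous subsets \<open>c n\<close> of the \<open>b n\<close> are refined to a
  homogeneous sequence \<open>R\<close>, and \<open>a\<close> is the union of its tails. Bigness of
  \<open>R\<close> makes \<open>a\<close> meet infinitely many \<open>b n\<close> in an infinite
  set.\<close>

lemma fresh_set_meeting:
  fixes b :: "nat \<Rightarrow> nat set"
  assumes S: "system S" and small: "|used S| <o |UNIV :: nat set set|"
    and b: "\<And>n. b n \<in> \<I>\<^sup>+ (fst ` S)"
  obtains p where "fresh S p" "\<exists>\<^sub>\<infinity>n. infinite (b n \<inter> fst p)"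
proof -
  have "\<exists>c \<eta>. c \<subseteq> b n \<and> infinite c \<and> \<eta> \<in> nodes \<and> homogeneous c \<eta> \<and>
      (\<forall>p\<in>S. finite (fst p \<inter> c)) \<and> (\<forall>w\<in>used S. \<not> \<eta> \<sqsubseteq> w)" for n
    using homogeneous_subset[OF S small b[of n]] .
  then obtain c \<eta> where c: "\<And>n. c n \<subseteq> b n" "\<And>n. infinite (c n)" "\<And>n. \<eta> n \<in> nodes"
    "\<And>n. homogeneous (c n) (\<eta> n)" "\<And>n p.  p \<in> S \<Longrightarrow> finite (fst p \<inter> c n)"
    "\<And>n w. w \<in> used S \<Longrightarrow> \<not> \<eta> n \<sqsubseteq> w" by metis
  have "big c" using c(2) unfolding big_def by simp
  obtain R \<tau> where R: "big R" "\<forall>n. R n \<subseteq> c n" "\<tau> \<in> nodes" "seq_homogeneous R \<tau>"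
    "\<forall>w\<in>used S. \<not> \<tau> \<sqsubseteq> w"
    by (rule homogeneous_refinement[OF \<open>big c\<close> small])
  have fin: "finite (fst p \<inter> R j)" if "p \<in> S" for p j
    using c(5)[OF that, of j] by (rule rev_finite_subset) (use R(2) in blast)
  then have "\<forall>p\<in>S. \<forall>\<^sub>\<infinity>j. finite (fst p \<inter> R j)" by simp
  note tails[OF S R(3,4,5) this]
  then obtain g where g1: "\<forall>e\<in>below (fst \<tau>). \<forall>\<^sub>\<infinity>j. R j \<inter> {g j..} \<subseteq> side (snd \<tau>) e"
    and g2: "\<forall>p\<in>S. \<forall>z\<in>snd p. \<not> incompatible z \<tau> \<longrightarrow> (\<forall>\<^sub>\<infinity>j. R j \<inter> {g j..} \<inter> fst p = {})"
    by (elim exE conjE)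
  define a where "a = (\<Union>j. R j \<inter> {g j..})"
  \<comment> \<open>Against a homogeneous set, \<tau> controls almost all tails, and
    \<open>\<eta> j\<close> handles the \<open>j\<close>-th one, which may be among the finitely
    many exceptions.\<close>
  define Z where "Z = insert \<tau> (range \<eta>)"
  \<comment> \<open>An exceptional term may now contribute infinitely many points, hence the extra
    assumption on each single term.\<close>
  have almost: "finite (a \<inter> A)"
    if ev: "\<forall>\<^sub>\<infinity>j. R j \<inter> {g j..} \<inter> A = {}" and fin: "\<And>j. finite (R j \<inter> A)" for A
  proof -
    obtain m where m: "\<And>j. j \<ge> m \<Longrightarrow> R j \<inter> {g j..} \<inter> A = {}"
      using ev unfolding MOST_nat_le by blast
    have "a \<inter> A \<subseteq> (\<Union>j<m. R j \<inter> A)"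
    proof
      fix y assume "y \<in> a \<inter> A"
      then obtain j where j: "y \<in> R j \<inter> {g j..} \<inter> A" unfolding a_def by blast
      then have "j < m" using m[of j] by (metis empty_iff not_le)
      then show "y \<in> (\<Union>j<m. R j \<inter> A)" using j by blast
    qed
    moreover have "finite (\<Union>j<m. R j \<inter> A)" using fin by (intro finite_UN_I) simp_all
    ultimately show ?thesis by (rule finite_subset)
  qed
  have off_side: "finite (a \<inter> (A - side (snd \<tau>) e))"
    if e: "e \<in> below (fst \<tau>)" and A: "\<And>j. finite (R j \<inter> A)" for A e
  proof (rule almost)
    show "\<forall>\<^sub>\<infinity>j. R j \<inter> {g j..} \<inter> (A - side (snd \<tau>) e) = {}"
      using bspec[OF g1 e] by (rule MOST_mono) blast
    show "finite (R j \<inter> (A - side (snd \<tau>) e))" for j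
      using A by (rule rev_finite_subset) blast
  qed
  have R_inf: "infinite (R j \<inter> {g j..})" if "infinite (R j)" for j
  proof -
    have "finite (R j \<inter> {..<g j})" by simp
    moreover have "R j = (R j \<inter> {..<g j}) \<union> (R j \<inter> {g j..})" by auto
    ultimately show ?thesis using that by (metis finite_UnI)
  qed
  have meets: "\<exists>\<^sub>\<infinity>n. infinite (b n \<inter> a)"
    using R(1) unfolding big_def
  proof (rule INFM_mono)
    fix n assume "infinite (R n)"
    moreover have "R n \<inter> {g n..} \<subseteq> b n \<inter> a" unfolding a_def using R(2) c(1) by blast
    ultimately show "infinite (b n \<inter> a)" using R_inf finite_subset by blast
  qed
  then have "infinite a" by (auto dest: INFM_EX)
  moreover have "guarded a Z"
    unfolding guarded_def
  proof (intro allI impI, elim conjE)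
    fix d \<rho> assume d: "homogeneous d \<rho>" "\<forall>z\<in>Z. incompatible z \<rho>"
    then obtain e where e: "e \<in> below (fst \<tau>)" "e \<in> below (fst \<rho>)"
      "side (snd \<tau>) e \<inter> side (snd \<rho>) e = {}"
      using incompatible_sides[of \<tau> \<rho>] unfolding Z_def by blast
    have "finite (R j \<inter> d)" for j
    proof -
      have "finite (c j \<inter> d)"
        using incompatible_homogeneous[OF _ c(4) d(1)] d(2) unfolding Z_def by blast
      then show ?thesis by (rule rev_finite_subset) (use R(2) in blast)
    qed
    from off_side[OF e(1) this] have "finite (a \<inter> (d - side (snd \<tau>) e))" .
    moreover have "finite (d - side (snd \<rho>) e)" using d(1) e(2) unfolding homogeneous_def by blast
    moreover have "a \<inter> d \<subseteq> (a \<inter> (d - side (snd \<tau>) e)) \<union> (d - side (snd \<rho>) e)"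
      using e(3) by blast
    ultimately show "finite (a \<inter> d)" by (meson finite_UnI finite_subset)
  qed
  moreover have "countable Z" "Z \<subseteq> nodes" unfolding Z_def using R(3) c(3) by auto
  moreover have "finite (fst p \<inter> a)" if p: "p \<in> S" for p
  proof (cases "\<forall>z\<in>snd p. incompatible z \<tau>")
    case True
    \<comment> \<open>Although \<open>a\<close> need not be homogeneous, its intersection with \<open>fst p\<close> is.\<close>
    have fin': "finite (R j \<inter> fst p)" for j using fin[OF p, of j] by (simp add: Int_commute)
    have "homogeneous (fst p \<inter> a) \<tau>"
      unfolding homogeneous_def
    proof
      fix e assume "e \<in> below (fst \<tau>)"
      then have "finite (a \<inter> (fst p - side (snd \<tau>) e))" using off_side fin' by blast
      moreover have "fst p \<inter> a - side (snd \<tau>) e = a \<inter> (fst p - side (snd \<tau>) e)" by blast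
      ultimately show "finite (fst p \<inter> a - side (snd \<tau>) e)" by simp
    qed
    then have "finite (fst p \<inter> (fst p \<inter> a))"
      using system_admissible[OF S p] True guardedD unfolding admissible_def by blast
    then show ?thesis by simp
  next
    case False
    then obtain z where "z \<in> snd p" "\<not> incompatible z \<tau>" by blast
    with g2 p have "\<forall>\<^sub>\<infinity>j. R j \<inter> {g j..} \<inter> fst p = {}" by blast
    then have "finite (a \<inter> fst p)"
      by (rule almost) (use fin[OF p] in \<open>simp add: Int_commute\<close>)
    then show ?thesis by (simp add: Int_commute)
  qed
  moreover have "Z \<inter> used S = {}"
    unfolding Z_def using R(5) c(6) initial_refl by blast
  ultimately have "fresh S (a, Z)" unfolding fresh_def admissible_def by simp
  then show thesis using meets by (intro that[of "(a, Z)"]) simp_all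
qed

end

section \<open>The recursion\<close>

lemma positive_sets_antimono: "\<A> \<subseteq> \<B> \<Longrightarrow> \<I>\<^sup>+ \<B> \<subseteq> \<I>\<^sup>+ \<A>"
  unfolding positive_sets_def generated_ideal_def by blast

lemma positive_sets_empty: "b \<in> \<I>\<^sup>+ {} \<longleftrightarrow> infinite b"
  unfolding positive_sets_def by (simp add: mem_generated_ideal_iff)

context splitting_tree
begin

lemma system_empty: "system {}"
  unfolding system_def by simp

text \<open>Otherwise finitely many members would almost cover \<omega>, and any further member
  would be finite.\<close>

lemma UNIV_positive:
  assumes S: "system S" and inf: "infinite (fst ` S)"
  shows "UNIV \<in> \<I>\<^sup>+ (fst ` S)"
proof (rule ccontr)
  assume "\<not> ?thesis"
  then obtain \<F> where F: "finite \<F>" "\<F> \<subseteq> fst ` S" "finite (UNIV - \<Union>\<F>)"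
    unfolding positive_sets_def by (auto simp: mem_generated_ideal_iff)
  have "\<not> fst ` S \<subseteq> \<F>" using F(1) inf finite_subset by blast
  then obtain p where p: "p \<in> S" "fst p \<notin> \<F>" by blast
  have "finite (fst p \<inter> a)" if a: "a \<in> \<F>" for a
  proof -
    obtain q where q: "q \<in> S" "a = fst q" using a F(2) by blast
    then have "p \<noteq> q" using p(2) a by blast
    then show ?thesis using system_almost_disjoint[OF S p(1) q(1)] q(2) by simp
  qed
  then have "finite (\<Union>a\<in>\<F>. fst p \<inter> a)" using F(1) by blast
  moreover have "fst p \<subseteq> (\<Union>a\<in>\<F>. fst p \<inter> a) \<union> (UNIV - \<Union>\<F>)" by blast
  ultimately have "finite (fst p)" using F(3) by (meson finite_UnI finite_subset)
  then show False using system_admissible[OF S p(1)] unfolding admissible_def by blast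
qed

text \<open>An infinite start keeps \<open>UNIV\<close> positive throughout the recursion. Each
  column of a pairing function supplies one homogeneous set, which its own node guards.\<close>

lemma countable_system:
  obtains S where "system S" "countable S" "infinite (fst ` S)"
proof -
  define P where "P k = range (\<lambda>j. prod_encode (k, j))" for k
  have P_inf: "infinite (P k)" for k
    unfolding P_def by (intro range_inj_infinite injI) simp
  have P_disj: "P k \<inter> P l = {}" if "k \<noteq> l" for k l
    unfolding P_def using that by auto
  have "|used {}| <o |UNIV :: nat set set|"
    by (rule countable_less_nat_sets) (simp add: used_def)
  then have "\<exists>c \<eta>. c \<subseteq> P k \<and> infinite c \<and> \<eta> \<in> nodes \<and> homogeneous c \<eta>" for k
    using homogeneous_subset[OF system_empty, of "P k"] P_inf positive_sets_empty by auto
  then obtain c \<eta> where c: "\<And>k. c k \<subseteq> P k" "\<And>k. infinite (c k)" "\<And>k. \<eta> k \<in> nodes"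
    "\<And>k. homogeneous (c k) (\<eta> k)" by metis
  define S where "S = range (\<lambda>k. (c k, {\<eta> k}))"
  have disj: "c k \<inter> c l = {}" if "k \<noteq> l" for k l using P_disj[OF that] c(1) by blast
  have "inj c"
  proof (rule injI, rule ccontr)
    fix k l assume "c k = c l" "k \<noteq> l"
    then show False using disj[of k l] c(2)[of k] by auto
  qed
  then have "infinite (range c)" by (rule range_inj_infinite)
  then have "infinite (fst ` S)" unfolding S_def image_image by simp
  moreover have "countable S" unfolding S_def by simp
  moreover have "system S"
    unfolding system_def
  proof (intro conjI ballI impI allI)
    have "guarded (c k) {\<eta> k}" for k
      unfolding guarded_def using incompatible_homogeneous[OF _ c(4)] by blast
    then show "admissible p" if "p \<in> S" for p
      using that c(2,3) unfolding S_def admissible_def by auto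
    show "finite (fst p \<inter> fst q)" if pq: "p \<in> S" "q \<in> S" "p \<noteq> q" for p q
    proof -
      obtain k l where "p = (c k, {\<eta> k})" "q = (c l, {\<eta> l})"
        using pq(1,2) unfolding S_def by blast
      then show ?thesis using disj[of k l] pq(3) by (cases "k = l") simp_all
    qed
    show "countable {p \<in> S. z \<in> snd p}" for z
      using \<open>countable S\<close> by (rule countable_subset[rotated]) blast
  qed
  ultimately show thesis by (intro that)
qed

text \<open>Even when some \<open>b n\<close> is not positive a fresh set is added, by treating the
  constant sequence \<open>UNIV\<close>; thus every stage contributes to the size of the
  family.\<close>

lemma fresh_extension:
  assumes S: "system S" "|S| <o |UNIV :: nat set set|" "UNIV \<in> \<I>\<^sup>+ (fst ` S)"
  shows "\<exists>p. fresh S p \<and> ((\<forall>n. b n \<in> \<I>\<^sup>+ (fst ` S)) \<longrightarrow> (\<exists>\<^sub>\<infinity>n::nat. infinite (b n \<inter> fst p)))"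
proof (cases "\<forall>n. b n \<in> \<I>\<^sup>+ (fst ` S)")
  case True
  then show ?thesis
    using fresh_set_meeting[OF S(1) used_small[OF S(1,2)], of b] by metis
next
  case False
  obtain p where "fresh S p"
    using fresh_set_meeting[OF S(1) used_small[OF S(1,2)], of "\<lambda>_. UNIV"] S(3) by metis
  then show ?thesis using False by blast
qed

text \<open>Of two added members the later is fresh over the earlier, so a node occurs in at most
  one of them besides the countably many members of \<open>S0\<close>. The index set
  \<open>U\<close> covers both the stages before a given one and the whole recursion.\<close>

lemma system_Un:
  assumes S0: "system S0" "countable S0"
    and fresh: "\<And>\<delta>. \<delta> \<in> U \<Longrightarrow> fresh (S0 \<union> G ` underS r \<delta>) (G \<delta>)"
    and linear: "\<And>\<delta> \<epsilon>. \<delta> \<in> U \<Longrightarrow> \<epsilon> \<in> U \<Longrightarrow> \<delta> = \<epsilon> \<or> \<delta> \<in> underS r \<epsilon> \<or> \<epsilon> \<in> underS r \<delta>"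
  shows "system (S0 \<union> G ` U)"
proof -
  have pre: "finite (fst q \<inter> fst (G \<delta>)) \<and> snd q \<inter> snd (G \<delta>) = {}"
    if "\<delta> \<in> U" "q \<in> S0 \<union> G ` underS r \<delta>" for q \<delta>
    using fresh[OF that(1)] that(2) unfolding fresh_def used_def by blast
  have U: "finite (fst (G \<delta>) \<inter> fst (G \<epsilon>)) \<and> snd (G \<delta>) \<inter> snd (G \<epsilon>) = {}"
    if "\<delta> \<in> U" "\<epsilon> \<in> U" "\<delta> \<noteq> \<epsilon>" for \<delta> \<epsilon>
    using linear[OF that(1,2)] that(3) pre[OF that(1), of "G \<epsilon>"] pre[OF that(2), of "G \<delta>"]
    by (auto simp: Int_commute)
  show ?thesis
    unfolding system_def
  proof (intro conjI ballI impI allI)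
    show "admissible p" if "p \<in> S0 \<union> G ` U" for p
      using that system_admissible[OF S0(1)] fresh unfolding fresh_def by blast
    show "finite (fst p \<inter> fst q)" if p: "p \<in> S0 \<union> G ` U" and q: "q \<in> S0 \<union> G ` U" and "p \<noteq> q" for p q
    proof (cases "p \<in> S0")
      case p0: True
      show ?thesis
      proof (cases "q \<in> S0")
        case True
        then show ?thesis using system_almost_disjoint[OF S0(1) p0] \<open>p \<noteq> q\<close> by blast
      next
        case False
        then show ?thesis using q pre[of _ p] p0 by blast
      qed
    next
      case False
      then obtain \<delta> where d: "\<delta> \<in> U" "p = G \<delta>" using p by blast
      show ?thesis
      proof (cases "q \<in> S0")
        case True
        then show ?thesis using d pre[of \<delta> q] by (simp add: Int_commute)
      next
        case False
        then obtain \<epsilon> where e: "\<epsilon> \<in> U" "q = G \<epsilon>" using q by blast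
        then show ?thesis using U[OF d(1) e(1)] d(2) \<open>p \<noteq> q\<close> by auto
      qed
    qed
    show "countable {p \<in> S0 \<union> G ` U. z \<in> snd p}" for z
    proof -
      have single: "\<delta> = \<epsilon>" if "\<delta> \<in> U" "z \<in> snd (G \<delta>)" "\<epsilon> \<in> U" "z \<in> snd (G \<epsilon>)" for \<delta> \<epsilon>
        using U[OF that(1,3)] that(2,4) by blast
      have "countable {\<delta> \<in> U. z \<in> snd (G \<delta>)}"
      proof (cases "\<exists>\<delta>\<in>U. z \<in> snd (G \<delta>)")
        case True
        then obtain \<delta> where "\<delta> \<in> U" "z \<in> snd (G \<delta>)" by blast
        then have "{\<delta> \<in> U. z \<in> snd (G \<delta>)} \<subseteq> {\<delta>}" using single by blast
        then show ?thesis by (rule countable_subset) simp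
      next
        case False
        then have "{\<delta> \<in> U. z \<in> snd (G \<delta>)} = {}" by blast
        then show ?thesis by (simp only: countable_empty)
      qed
      then have "countable (G ` {\<delta> \<in> U. z \<in> snd (G \<delta>)})" by (rule countable_image)
      then have "countable (S0 \<union> G ` {\<delta> \<in> U. z \<in> snd (G \<delta>)})" using S0(2) by simp
      then show ?thesis by (rule countable_subset[rotated]) blast
    qed
  qed
qed

text \<open>The recursion follows a well-order of minimal length, so every stage sees fewer than
  continuum many members. Stage \<delta> treats the sequence that \<delta> codes.\<close>

lemma weakly_tight_of_nat_sets_size:
  obtains \<A> where "weakly_tight \<A>" "|\<A>| =o |UNIV :: nat set set|"
proof -
  obtain S0 where S0: "system S0" "countable S0" "infinite (fst ` S0)"
    by (rule countable_system)
  \<comment> \<open>Through the pairing function every sequence of sets of numbers is coded by one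
    such set.\<close>
  define b where "b \<delta> n = {j. prod_encode (n, j) \<in> \<delta>}" for \<delta> :: "nat set" and n
  have b_surj: "\<exists>\<delta>. b \<delta> = B" for B
  proof
    show "b {prod_encode (n, j) | n j. j \<in> B n} = B" unfolding b_def by auto
  qed
  let ?r = "|UNIV :: nat set set|"
  define good where "good S \<delta> p \<longleftrightarrow> fresh S p \<and>
    ((\<forall>n. b \<delta> n \<in> \<I>\<^sup>+ (fst ` S)) \<longrightarrow> (\<exists>\<^sub>\<infinity>n::nat. infinite (b \<delta> n \<inter> fst p)))" for S \<delta> p
  define G where "G = wfrec (?r - Id) (\<lambda>h \<delta>. SOME p. good (S0 \<union> h ` underS ?r \<delta>) \<delta> p)"
  have wo: "Well_order ?r" by (rule card_of_Well_order)
  then have wf: "wf (?r - Id)" by (simp add: well_order_on_def)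
  have linear: "\<delta> = \<epsilon> \<or> \<delta> \<in> underS ?r \<epsilon> \<or> \<epsilon> \<in> underS ?r \<delta>" for \<delta> \<epsilon>
    using wo unfolding underS_def well_order_on_def linear_order_on_def total_on_def
    by (auto simp: Field_card_of)
  have G: "G \<delta> = (SOME p. good (S0 \<union> G ` underS ?r \<delta>) \<delta> p)" for \<delta>
  proof -
    have "cut G (?r - Id) \<delta> ` underS ?r \<delta> = G ` underS ?r \<delta>"
      by (rule image_cong) (auto simp: underS_def cut_apply)
    with def_wfrec[OF G_def[THEN eq_reflection] wf, of \<delta>] show ?thesis by simp
  qed
  have infinite_fst: "infinite (fst ` (S0 \<union> A))" for A
    using S0(3) by (auto simp: image_Un)
  have good: "good (S0 \<union> G ` underS ?r \<delta>) \<delta> (G \<delta>)" for \<delta>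
    using wf
  proof (induction \<delta> rule: wf_induct_rule)
    case (less \<delta>)
    let ?S = "S0 \<union> G ` underS ?r \<delta>"
    have "fresh (S0 \<union> G ` underS ?r \<epsilon>) (G \<epsilon>)" if "\<epsilon> \<in> underS ?r \<delta>" for \<epsilon>
      using less[of \<epsilon>] that unfolding good_def underS_def by blast
    then have sys: "system ?S"
      by (rule system_Un[OF S0(1,2)]) (use linear in auto)
    have "|underS ?r \<delta>| <o ?r"
      by (rule card_of_underS[OF card_of_Card_order]) (simp add: Field_card_of)
    then have "|G ` underS ?r \<delta>| <o ?r"
      by (rule ordLeq_ordLess_trans[OF card_of_image])
    moreover have "infinite (UNIV :: nat set set)" by (simp add: Finite_Set.finite_set)
    ultimately have "|?S| <o ?r"
      using countable_less_nat_sets[OF S0(2)] by (intro card_of_Un_ordLess_infinite)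
    then have "\<exists>p. good ?S \<delta> p"
      unfolding good_def using fresh_extension[OF sys] UNIV_positive[OF sys infinite_fst] by blast
    then show ?case unfolding G[of \<delta>] by (rule someI_ex)
  qed
  define T where "T = S0 \<union> range G"
  have T: "system T"
    unfolding T_def using good linear
    by (intro system_Un[OF S0(1,2), of UNIV G ?r]) (auto simp: good_def)
  have "almost_disjoint (fst ` T)"
    unfolding almost_disjoint_def
  proof (intro conjI ballI impI)
    show "infinite a" if "a \<in> fst ` T" for a
      using that system_admissible[OF T] unfolding admissible_def by blast
    show "finite (a \<inter> a')" if "a \<in> fst ` T" "a' \<in> fst ` T" "a \<noteq> a'" for a a'
      using that system_almost_disjoint[OF T] by blast
  qed
  moreover have "\<exists>a\<in>fst ` T. \<exists>\<^sub>\<infinity>n. infinite (B n \<inter> a)"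
    if B: "\<forall>n. B n \<in> \<I>\<^sup>+ (fst ` T)" for B :: "nat \<Rightarrow> nat set"
  proof -
    obtain \<delta> where \<delta>: "b \<delta> = B" using b_surj by blast
    \<comment> \<open>Sets positive over the final family are positive over the part present at
      stage \<delta>, so the member chosen there meets the sequence.\<close>
    have "fst ` (S0 \<union> G ` underS ?r \<delta>) \<subseteq> fst ` T" unfolding T_def by blast
    from positive_sets_antimono[OF this] have "\<exists>\<^sub>\<infinity>n. infinite (B n \<inter> fst (G \<delta>))"
      using good[of \<delta>] B unfolding good_def \<delta> by blast
    then show ?thesis unfolding T_def by blast
  qed
  ultimately have "weakly_tight (fst ` T)" unfolding weakly_tight_def by blast
  moreover have "|fst ` T| =o ?r"
  proof -
    \<comment> \<open>The later of two sets is infinite and almost disjoint from the earlier one, so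
      they differ.\<close>
    have "inj (\<lambda>\<delta>. fst (G \<delta>))"
    proof (rule injI, rule ccontr)
      have less: False if "fst (G \<delta>) = fst (G \<epsilon>)" "\<delta> \<in> underS ?r \<epsilon>" for \<delta> \<epsilon>
      proof -
        have "finite (fst (G \<delta>) \<inter> fst (G \<epsilon>))" "infinite (fst (G \<epsilon>))"
          using good[of \<epsilon>] that(2) unfolding good_def fresh_def admissible_def by blast+
        with that(1) show False by simp
      qed
      fix \<delta> \<epsilon> assume "fst (G \<delta>) = fst (G \<epsilon>)" "\<delta> \<noteq> \<epsilon>"
      then show False using linear[of \<delta> \<epsilon>] less[of \<delta> \<epsilon>] less[of \<epsilon> \<delta>] by auto
    qed
    then have "?r \<le>o |fst ` T|"
      by (rule card_of_ordLeqI) (simp add: T_def)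
    moreover have "|fst ` T| \<le>o ?r" by (rule card_of_mono1) simp
    ultimately show ?thesis by (simp add: ordIso_iff_ordLeq)
  qed
  ultimately show thesis by (rule that)
qed

end

section \<open>The size continuum and the three claims\<close>

lemma nat_sets_continuum: "|UNIV :: nat set set| =o continuum"
proof -
  have "bij_betw (\<lambda>s n. n \<in> s) (UNIV :: nat set set) (Func (Field natLeq) (Field ctwo))"
    unfolding bij_betw_def
  proof
    show "inj (\<lambda>(s :: nat set) n. n \<in> s)" by (rule injI) (metis Collect_mem_eq)
    have "f \<in> range (\<lambda>s n. n \<in> s)" for f :: "nat \<Rightarrow> bool"
      by (rule image_eqI[of _ _ "Collect f"]) auto
    then show "range (\<lambda>s n. n \<in> s) = Func (Field natLeq) (Field ctwo)"
      by (auto simp: Func_def ctwo_def Field_card_of Field_natLeq)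
  qed
  then show ?thesis
    unfolding continuum_def cexp_def by (rule card_of_ordIsoI)
qed

lemma weakly_tight_continuum:
  assumes "\<ss> \<le>o \<bb>"
  shows "\<exists>\<A>. weakly_tight \<A> \<and> |\<A>| =o continuum"
proof -
  obtain E where "|E| \<le>o \<bb>"
    "\<And>Q. big Q \<Longrightarrow> \<exists>e\<in>E. big (\<lambda>n. Q n \<inter> e) \<and> big (\<lambda>n. Q n - e)"
    using sequence_splitting_family[OF assms] by metis
  then interpret splitting_tree E
    by unfold_locales (simp_all add: splits_def)
  obtain \<A> where "weakly_tight \<A>" "|\<A>| =o |UNIV :: nat set set|"
    by (rule weakly_tight_of_nat_sets_size)
  then show ?thesis using nat_sets_continuum ordIso_transitive by blast
qed

lemma omega_1_le_bounding_number: "omega_1 \<le>o \<bb>"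
proof -
  obtain B where "|B| = \<bb>" using bounding_number_witness by metis
  then have "Card_order \<bb>" using card_of_Card_order[of B] by simp
  then show ?thesis
    unfolding omega_1_def
    by (rule cardSuc_least[OF natLeq_Card_order _ natLeq_less_bounding_number])
qed

theorem theorem16:
  fixes \<kappa> :: "'k rel"
  shows "(Card_order \<kappa> \<and> \<kappa> =o \<ss> \<and> \<kappa> =o \<bb> \<and> P_principle \<kappa>
            \<longrightarrow> (\<exists>\<A>. weakly_tight \<A> \<and> |\<A>| =o continuum)) \<and>
         (\<ss> \<le>o \<bb> \<and> below_aleph_omega \<bb>
            \<longrightarrow> (\<exists>\<A>. weakly_tight \<A> \<and> |\<A>| =o continuum)) \<and>
         (\<ss> =o omega_1
            \<longrightarrow> (\<exists>\<A>. weakly_tight \<A> \<and> |\<A>| =o continuum))"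
proof (intro conjI impI; (elim conjE)?)
  assume "\<kappa> =o \<ss>" "\<kappa> =o \<bb>"
  then have "\<ss> =o \<bb>" using ordIso_symmetric ordIso_transitive by blast
  then show "\<exists>\<A>. weakly_tight \<A> \<and> |\<A>| =o continuum"
    by (intro weakly_tight_continuum ordIso_imp_ordLeq)
next
  assume "\<ss> \<le>o \<bb>"
  then show "\<exists>\<A>. weakly_tight \<A> \<and> |\<A>| =o continuum" by (rule weakly_tight_continuum)
next
  assume "\<ss> =o omega_1"
  then have "\<ss> \<le>o \<bb>" using omega_1_le_bounding_number by (rule ordIso_ordLeq_trans)
  then show "\<exists>\<A>. weakly_tight \<A> \<and> |\<A>| =o continuum" by (rule weakly_tight_continuum)
qed

end
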